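(* Let $K=\mathbb{F}_q$ be a finite field with $q$ elements. Let $\mathcal{C}$ be a clutter with vertex set $\{y_1,\ldots,y_n\}$ and with $s\geq 1$ edges, let $v_1,\ldots,v_s$ be the characteristic vectors of the edges of $\mathcal{C}$, let $X\subset\mathbb{P}^{s-1}$ be the algebraic toric set parameterized by $y^{v_1},\ldots,y^{v_s}$, and let $I(X)\subset S=K[t_1,\ldots,t_s]$ be its vanishing ideal. Let $\mathbb{T}=\{[(x_1,\ldots,x_s)]\in\mathbb{P}^{s-1}\mid x_i\in K^*\text{ for all } i\}$ be the projective torus. The following are equivalent: (1) $I(X)$ is a complete intersection. (2) $I(X)=(t_1^{q-1}-t_s^{q-1},\ldots,t_{s-1}^{q-1}-t_s^{q-1})$. (3) $X=\mathbb{T}$.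
   Context: A clutter $\mathcal{C}$ is a family $E$ of subsets (called edges) of a finite ground set $Y=\{y_1,\ldots,y_n\}$ (the vertex set) such that if $f_1,f_2\in E$ are distinct, then $f_1\not\subset f_2$. The characteristic vector of an edge $f$ is $\sum_{y_i\in f}e_i$, where $e_i$ is the $i$-th unit vector in $\mathbb{R}^n$; $v_1,\ldots,v_s$ is the list of the (distinct) characteristic vectors of all edges of $\mathcal{C}$, and $v_i=(v_{i1},\ldots,v_{in})\in\mathbb{N}^n$, where $\mathbb{N}$ includes $0$. With $K^*=K\setminus\{0\}$ and $\mathbb{P}^{s-1}$ the projective space of dimension $s-1$ over $K$, the algebraic toric set parameterized by $y^{v_1},\ldots,y^{v_s}$ is $$X=\{[(x_1^{v_{11}}\cdots x_n^{v_{1n}},\ldots,x_1^{v_{s1}}\cdots x_n^{v_{sn}})]\in\mathbb{P}^{s-1}\mid x_i\in K^*\text{ for all }i\}.$$ $S=K[t_1,\ldots,t_s]$ has the standard grading; $I(X)$ is the ideal of $S$ generated by the homogeneous polynomials of $S$ that vanish on $X$. The ideal $I(X)$ is called a complete intersection if it can be generated by $s-1$ homogeneous polynomials of $S$. *)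

theory Defs
  imports "HOL-Library.Poly_Mapping" "HOL-Library.FuncSet" "HOL-Algebra.Ideal"
begin

section \<open>Clutters and their characteristic vectors\<close>

definition clutter :: "'v set \<Rightarrow> 'v set set \<Rightarrow> bool" where
  "clutter V E \<longleftrightarrow> finite V \<and> E \<subseteq> Pow V \<and>
     (\<forall>f1\<in>E. \<forall>f2\<in>E. f1 \<noteq> f2 \<longrightarrow> \<not> f1 \<subset> f2)"

text \<open>
  Vertices are enumerated as \<open>y 1, \<dots>, y n\<close>.  Vectors in \<open>\<nat>\<^sup>n\<close> are finitely supported
  functions \<open>nat \<Rightarrow>\<^sub>0 nat\<close> supported in \<open>{1..n}\<close>.
\<close>

definition char_vec :: "(nat \<Rightarrow> 'v) \<Rightarrow> nat \<Rightarrow> 'v set \<Rightarrow> (nat \<Rightarrow>\<^sub>0 nat)" where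
  "char_vec y n f = (\<Sum>i | i \<in> {1..n} \<and> y i \<in> f. Poly_Mapping.single i 1)"


section \<open>The polynomial ring in the variables \<open>t\<^sub>1, \<dots>, t\<^sub>s\<close>\<close>

text \<open>
  A polynomial in countably many variables is a finitely supported map from monomials
  (exponent vectors \<open>nat \<Rightarrow>\<^sub>0 nat\<close>) to coefficients; its ring operations are those of
  \<open>HOL-Library.Poly_Mapping\<close>.
\<close>

type_synonym 'a mpol = "(nat \<Rightarrow>\<^sub>0 nat) \<Rightarrow>\<^sub>0 'a"

definition tvar :: "nat \<Rightarrow> 'a::comm_ring_1 mpol" where
  "tvar i = Poly_Mapping.single (Poly_Mapping.single i 1) 1"

definition poly_ring :: "nat \<Rightarrow> 'a::comm_ring_1 mpol ring" where
  "poly_ring s = \<lparr>carrier = {p. \<forall>m\<in>Poly_Mapping.keys p. Poly_Mapping.keys m \<subseteq> {1..s}},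
     mult = (*), one = 1, zero = 0, add = (+)\<rparr>"

definition mon_degree :: "(nat \<Rightarrow>\<^sub>0 nat) \<Rightarrow> nat" where
  "mon_degree m = (\<Sum>i\<in>Poly_Mapping.keys m. Poly_Mapping.lookup m i)"

text \<open>As usual, the zero polynomial counts as homogeneous.\<close>

definition homogeneous :: "'a::comm_ring_1 mpol \<Rightarrow> bool" where
  "homogeneous p \<longleftrightarrow> (\<exists>d. \<forall>m\<in>Poly_Mapping.keys p. mon_degree m = d)"

definition mpol_eval :: "'a::comm_ring_1 mpol \<Rightarrow> (nat \<Rightarrow> 'a) \<Rightarrow> 'a" where
  "mpol_eval p x = (\<Sum>m\<in>Poly_Mapping.keys p. Poly_Mapping.lookup p m *
     (\<Prod>i\<in>Poly_Mapping.keys m. x i ^ Poly_Mapping.lookup m i))"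


section \<open>Projective space\<close>

text \<open>
  Vectors of \<open>K\<^sup>s\<close> are functions on \<open>{1..s}\<close> (extended by \<open>undefined\<close>, as for \<open>\<rightarrow>\<^sub>E\<close>), and a
  point of \<open>\<bbbP>\<^bsup>s-1\<^esup>\<close> is a class of nonzero vectors modulo nonzero scalars.
\<close>

definition nonzero_vecs :: "nat \<Rightarrow> (nat \<Rightarrow> 'a::field) set" where
  "nonzero_vecs s = {x \<in> {1..s} \<rightarrow>\<^sub>E UNIV. \<exists>i\<in>{1..s}. x i \<noteq> 0}"

definition proportional :: "nat \<Rightarrow> ((nat \<Rightarrow> 'a::field) \<times> (nat \<Rightarrow> 'a)) set" where
  "proportional s = {(x, x'). x \<in> nonzero_vecs s \<and> x' \<in> nonzero_vecs s \<and>
     (\<exists>c. c \<noteq> 0 \<and> (\<forall>i\<in>{1..s}. x' i = c * x i))}"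

definition proj_space :: "nat \<Rightarrow> (nat \<Rightarrow> 'a::field) set set" where
  "proj_space s = nonzero_vecs s // proportional s"

definition proj_point :: "nat \<Rightarrow> (nat \<Rightarrow> 'a::field) \<Rightarrow> (nat \<Rightarrow> 'a) set" where
  "proj_point s x = proportional s `` {restrict x {1..s}}"

definition proj_torus :: "nat \<Rightarrow> (nat \<Rightarrow> 'a::field) set set" where
  "proj_torus s = {P \<in> proj_space s. \<exists>x. (\<forall>i\<in>{1..s}. x i \<noteq> 0) \<and> P = proj_point s x}"

text \<open>The set parameterized by the monomials with exponent vectors \<open>v 1, \<dots>, v s\<close>.\<close>

definition toric_set :: "nat \<Rightarrow> nat \<Rightarrow> (nat \<Rightarrow> nat \<Rightarrow>\<^sub>0 nat) \<Rightarrow> (nat \<Rightarrow> 'a::field) set set" where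
  "toric_set n s v = {P \<in> proj_space s. \<exists>x. (\<forall>i\<in>{1..n}. x i \<noteq> 0) \<and>
     P = proj_point s (\<lambda>j. \<Prod>i\<in>{1..n}. x i ^ Poly_Mapping.lookup (v j) i)}"


section \<open>Vanishing ideals\<close>

text \<open>
  A polynomial vanishes at a point if it is zero at all representatives; for homogeneous
  polynomials one representative suffices.
\<close>

definition vanishes_on :: "'a::field mpol \<Rightarrow> (nat \<Rightarrow> 'a) set set \<Rightarrow> bool" where
  "vanishes_on p X \<longleftrightarrow> (\<forall>P\<in>X. \<forall>x\<in>P. mpol_eval p x = 0)"

definition vanishing_ideal :: "nat \<Rightarrow> (nat \<Rightarrow> 'a::field) set set \<Rightarrow> 'a mpol set" where
  "vanishing_ideal s X = Idl\<^bsub>poly_ring s\<^esub>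
     {p \<in> carrier (poly_ring s). homogeneous p \<and> vanishes_on p X}"

text \<open>
  The generators \<open>f 1, \<dots>, f (s - 1)\<close> need not be distinct; for \<open>s = 1\<close> there are none and the
  ideal is zero.
\<close>

definition complete_intersection :: "nat \<Rightarrow> 'a::field mpol set \<Rightarrow> bool" where
  "complete_intersection s I \<longleftrightarrow>
     (\<exists>f. (\<forall>i\<in>{1..s-1}. f i \<in> carrier (poly_ring s) \<and> homogeneous (f i)) \<and>
          I = Idl\<^bsub>poly_ring s\<^esub> (f ` {1..s-1}))"


section \<open>Well-formedness of the encodings\<close>

lemma poly_ring_cring: "cring (poly_ring s :: 'a::comm_ring_1 mpol ring)"
proof (rule cringI)
  have neg: "- p \<in> carrier (poly_ring s)" if "p \<in> carrier (poly_ring s)" for p :: "'a mpol"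
    using that by (simp add: poly_ring_def in_keys_iff)
  show "abelian_group (poly_ring s :: 'a mpol ring)"
  proof (rule abelian_groupI)
    fix p q :: "'a mpol"
    assume "p \<in> carrier (poly_ring s)" "q \<in> carrier (poly_ring s)"
    then show "p \<oplus>\<^bsub>poly_ring s\<^esub> q \<in> carrier (poly_ring s)"
      using keys_add[of p q] by (auto simp: poly_ring_def)
  next
    fix p :: "'a mpol"
    assume "p \<in> carrier (poly_ring s)"
    then show "\<exists>q\<in>carrier (poly_ring s). q \<oplus>\<^bsub>poly_ring s\<^esub> p = \<zero>\<^bsub>poly_ring s\<^esub>"
      using neg by (intro bexI[of _ "- p"]) (auto simp: poly_ring_def)
  qed (auto simp: poly_ring_def add_ac)
  show "Group.comm_monoid (poly_ring s :: 'a mpol ring)"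
  proof (rule comm_monoidI)
    fix p q :: "'a mpol"
    assume pq: "p \<in> carrier (poly_ring s)" "q \<in> carrier (poly_ring s)"
    have "Poly_Mapping.keys (a + b) \<subseteq> {1..s}"
      if "a \<in> Poly_Mapping.keys p" "b \<in> Poly_Mapping.keys q" for a b
      using that pq keys_add[of a b] unfolding poly_ring_def
      by (simp del: One_nat_def) blast
    then show "p \<otimes>\<^bsub>poly_ring s\<^esub> q \<in> carrier (poly_ring s)"
      using keys_mult[of p q] by (fastforce simp: poly_ring_def)
  qed (auto simp: poly_ring_def mult_ac)
qed (auto simp: poly_ring_def algebra_simps)

lemma tvar_in_poly_ring: "i \<in> {1..s} \<Longrightarrow> tvar i \<in> carrier (poly_ring s)"
  by (auto simp: tvar_def poly_ring_def)

lemma equiv_proportional: "equiv (nonzero_vecs s) (proportional s :: ((nat \<Rightarrow> 'a::field) \<times> (nat \<Rightarrow> 'a)) set)"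
  (is "equiv ?V ?R")
  unfolding equiv_def
proof (intro conjI)
  show "?R \<subseteq> ?V \<times> ?V"
    by (auto simp: proportional_def)
  show "refl_on ?V ?R"
    by (auto simp: refl_on_def proportional_def intro!: exI[of _ 1])
  show "sym ?R"
  proof (rule symI)
    fix x x' :: "nat \<Rightarrow> 'a"
    assume "(x, x') \<in> proportional s"
    then obtain c where "c \<noteq> 0" "x \<in> nonzero_vecs s" "x' \<in> nonzero_vecs s"
      "\<forall>i\<in>{1..s}. x' i = c * x i"
      by (auto simp: proportional_def)
    then show "(x', x) \<in> proportional s"
      by (auto simp: proportional_def intro!: exI[of _ "inverse c"])
  qed
  show "trans ?R"
  proof (rule transI)
    fix x x' x'' :: "nat \<Rightarrow> 'a"
    assume "(x, x') \<in> proportional s" "(x', x'') \<in> proportional s"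
    then obtain c d where "c \<noteq> 0" "d \<noteq> 0" "x \<in> nonzero_vecs s" "x'' \<in> nonzero_vecs s"
      "\<forall>i\<in>{1..s}. x' i = c * x i" "\<forall>i\<in>{1..s}. x'' i = d * x' i"
      by (auto simp: proportional_def)
    then show "(x, x'') \<in> proportional s"
      by (auto simp: proportional_def intro!: exI[of _ "d * c"])
  qed
qed

lemma proj_point_in_proj_space:
  assumes "s \<ge> 1" "\<forall>i\<in>{1..s}. x i \<noteq> 0"
  shows "proj_point s x \<in> proj_space s"
  unfolding proj_point_def proj_space_def
  using assms by (intro quotientI) (auto simp: nonzero_vecs_def intro!: bexI[of _ 1])

end

theory Submission
  imports Defs "HOL-Library.Cardinality" "Jordan_Normal_Form.Determinant"
begin

text \<open>
  Write \<open>N = q - 1\<close> and \<open>f\<^sub>i = t\<^sub>i\<^sup>N - t\<^sub>s\<^sup>N\<close>, and let \<open>J\<close> be the ideal generated by \<open>f\<^sub>1, \<dots>, f\<^bsub>s-1\<^esub>\<close>.  All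
  points of a toric set have representatives in \<open>(K\<^sup>*)\<^sup>s\<close>, so \<open>J\<close> is always contained in \<open>I(X)\<close>.  The
  arguments rest on the orthogonality of the monomial functions on \<open>(K\<^sup>*)\<^sup>I\<close>: if a linear combination
  of monomials vanishes there, its coefficients add up to zero over each class of exponent vectors
  modulo \<open>N\<close> (\<open>sum_coeffs_in_exponent_class\<close>).

  The heart of the matter is that a complete intersection \<open>I(X)\<close> equals \<open>J\<close>
  (\<open>torus_ideal_if_complete_intersection\<close>).  The reason is that the \<open>f\<^sub>i\<close> can be extended to a minimal
  set of generators: they are linearly independent in \<open>I(X) / \<mm> I(X)\<close>, where \<open>\<mm> = (t\<^sub>1, \<dots>, t\<^sub>s)\<close>.  Indeed a
  homogeneous element of \<open>I(X)\<close> contains no power \<open>t\<^sub>k\<^sup>b\<close> with \<open>b < N\<close> (\<open>pure_power_coeff_zero\<close>): in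
  terms of the parameters \<open>t\<^sub>k\<^sup>b\<close> becomes \<open>y\<^bsup>b v\<^sub>k\<^esup>\<close>, and since the \<open>v\<^sub>j\<close> are distinct vectors of zeros and
  ones, no other monomial of degree \<open>b\<close> has the same exponents modulo \<open>N\<close>.  So \<open>\<mm> I(X)\<close> contains no form
  of degree \<open>N\<close> in which some \<open>t\<^sub>k\<^sup>N\<close> occurs.  If \<open>I(X)\<close> is generated by \<open>s - 1\<close> forms, the \<open>s - 1\<close>
  classes of the \<open>f\<^sub>i\<close> are a basis of \<open>I(X) / \<mm> I(X)\<close>, and the \<open>f\<^sub>i\<close> generate \<open>I(X)\<close> by graded Nakayama.
  The formal proof makes this explicit with two mutually inverse matrices of coefficients.

  That \<open>J\<close> is the vanishing ideal of the torus \<open>\<bbbT>\<close> (\<open>vanishing_ideal_proj_torus\<close>) is orthogonality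
  again, after all exponents of \<open>t\<^sub>1, \<dots>, t\<^bsub>s-1\<^esub>\<close> have been reduced modulo \<open>J\<close> to less than \<open>N\<close>.
  Conversely, if \<open>I(X) = J\<close>, then \<open>I(X) = I(\<bbbT>)\<close>, and \<open>X = \<bbbT>\<close> because a point outside the finite set
  \<open>X\<close> is separated from it by a product of linear forms (\<open>separating_form\<close>).
\<close>

section \<open>Monomial functions over a finite field\<close>

lemma power_card_minus_one:
  fixes x :: "'a::{finite,field}"
  assumes "x \<noteq> 0"
  shows "x ^ (CARD('a) - 1) = 1"
proof -
  let ?U = "UNIV - {0 :: 'a}"
  have "(\<Prod>y\<in>?U. y) = (\<Prod>y\<in>?U. x * y)"
    by (rule prod.reindex_bij_witness[of _ "\<lambda>y. x * y" "\<lambda>y. y / x"]) (use assms in auto)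
  also have "\<dots> = x ^ (CARD('a) - 1) * (\<Prod>y\<in>?U. y)"
    by (simp add: prod.distrib card_Diff_subset)
  finally show ?thesis
    by simp
qed

lemma of_nat_card_eq_0: "of_nat (CARD('a)) = (0 :: 'a::{finite,field})"
proof -
  have "(\<Sum>y\<in>(UNIV :: 'a set). y) = (\<Sum>y\<in>UNIV. y + 1)"
    by (rule sum.reindex_bij_witness[of _ "\<lambda>y. y + 1" "\<lambda>y. y - 1"]) auto
  then show ?thesis
    by (simp add: sum.distrib)
qed

lemma two_le_card: "2 \<le> CARD('a::{finite,field})"
proof -
  have "card {0, 1 :: 'a} \<le> CARD('a)"
    by (intro card_mono) auto
  then show ?thesis
    by simp
qed

text \<open>
  Otherwise, with \<open>r = w mod (q - 1)\<close>, all \<open>q - 1\<close> nonzero elements would be roots of a nonzero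
  polynomial of degree \<open>r < q - 1\<close>.
\<close>

lemma ex_power_neq_one:
  assumes "\<not> (CARD('a::{finite,field}) - 1) dvd w"
  obtains g :: "'a::{finite,field}" where "g \<noteq> 0" "g ^ w \<noteq> 1"
proof (rule ccontr)
  assume "\<not> thesis"
  with that have one: "g ^ w = 1" if "g \<noteq> 0" for g :: 'a
    using that by blast
  define N r where "N = CARD('a) - 1" and "r = w mod N"
  have "N > 0"
    using two_le_card[where 'a='a] by (simp add: N_def)
  then have r: "0 < r" "r < N"
    using assms by (auto simp: N_def r_def dvd_eq_mod_eq_0)
  have "g ^ r = 1" if "g \<noteq> 0" for g :: 'a
  proof -
    have "g ^ w = (g ^ N) ^ (w div N) * g ^ r"
      by (simp add: r_def flip: power_mult power_add)
    then show ?thesis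
      using one[OF that] power_card_minus_one[OF that] by (simp add: N_def)
  qed
  then have roots: "UNIV - {0} \<subseteq> {x :: 'a. poly (monom 1 r - 1) x = 0}"
    by (auto simp: poly_monom)
  have "coeff (monom 1 r - 1 :: 'a poly) r = 1"
    using r by simp
  then have nz: "monom 1 r - 1 \<noteq> (0 :: 'a poly)"
    by (metis coeff_0 zero_neq_one)
  have "N = card (UNIV - {0 :: 'a})"
    by (simp add: N_def card_Diff_subset)
  also have "\<dots> \<le> card {x :: 'a. poly (monom 1 r - 1) x = 0}"
    by (intro card_mono roots) auto
  also have "\<dots> \<le> degree (monom 1 r - 1 :: 'a poly)"
    by (rule card_poly_roots_bound[OF nz])
  also have "\<dots> \<le> r"
    by (intro degree_diff_le) (auto simp: degree_monom_le)
  finally show False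
    using r by simp
qed

lemma sum_power_nonzero:
  "(\<Sum>x\<in>UNIV - {0 :: 'a::{finite,field}}. x ^ w) = (if (CARD('a) - 1) dvd w then -1 else 0)"
proof (cases "(CARD('a) - 1) dvd w")
  case True
  then obtain k where w: "w = (CARD('a) - 1) * k" ..
  have "(\<Sum>x\<in>UNIV - {0 :: 'a}. x ^ w) = (\<Sum>x\<in>UNIV - {0 :: 'a}. 1)"
    by (intro sum.cong) (auto simp: w power_mult power_card_minus_one simp del: One_nat_def)
  also have "\<dots> = of_nat (CARD('a)) - 1"
    using two_le_card[where 'a='a] by (simp add: card_Diff_subset of_nat_diff)
  finally show ?thesis
    using True by (simp add: of_nat_card_eq_0)
next
  case False
  then obtain g :: 'a where g: "g \<noteq> 0" "g ^ w \<noteq> 1"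
    by (rule ex_power_neq_one)
  have "(\<Sum>x\<in>UNIV - {0 :: 'a}. x ^ w) = (\<Sum>x\<in>UNIV - {0}. (g * x) ^ w)"
    by (rule sum.reindex_bij_witness[of _ "\<lambda>y. g * y" "\<lambda>y. y / g"]) (use g in auto)
  also have "\<dots> = g ^ w * (\<Sum>x\<in>UNIV - {0}. x ^ w)"
    by (simp add: power_mult_distrib sum_distrib_left)
  finally show ?thesis
    using g False by simp
qed

text \<open>
  The exponent \<open>(N - 1) * b\<close> plays the part of \<open>- b\<close> modulo \<open>N\<close>, so that the natural number
  \<open>a + (N - 1) * b\<close> can stand for the difference \<open>a - b\<close>.
\<close>

lemma dvd_add_mult_pred_iff:
  fixes N a b :: nat
  assumes "N \<ge> 1"
  shows "N dvd (a + (N - 1) * b) \<longleftrightarrow> a mod N = b mod N"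
proof -
  have "int (a + (N - 1) * b) = (int a - int b) + int N * int b"
    using assms by (cases N) (simp_all add: algebra_simps)
  then have "N dvd (a + (N - 1) * b) \<longleftrightarrow> int N dvd (int a - int b) + int N * int b"
    by (metis int_dvd_int_iff)
  also have "\<dots> \<longleftrightarrow> int N dvd (int a - int b)"
    by (rule dvd_add_left_iff) simp
  also have "\<dots> \<longleftrightarrow> a mod N = b mod N"
    by (metis mod_eq_dvd_iff of_nat_eq_iff zmod_int)
  finally show ?thesis .
qed

text \<open>
  Orthogonality of characters of the group \<open>(K\<^sup>*)\<^sup>I\<close>.  Multiplying the relation by the inverse of the
  character with exponents \<open>u\<close> and summing over the group kills every term whose exponents differ
  from \<open>u\<close> modulo \<open>q - 1\<close> and multiplies each of the others by the same sign.  The family of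
  monomials is indexed by an arbitrary set \<open>M\<close>, since pulling a polynomial back to the
  parameters of a toric set may send different monomials to the same exponent vector.
\<close>

lemma sum_coeffs_in_exponent_class:
  fixes c :: "'m \<Rightarrow> 'a::{finite,field}" and e :: "'m \<Rightarrow> 'i \<Rightarrow> nat"
  assumes fin: "finite M" "finite I"
    and zero: "\<And>x. \<forall>i\<in>I. x i \<noteq> 0 \<Longrightarrow> (\<Sum>m\<in>M. c m * (\<Prod>i\<in>I. x i ^ e m i)) = 0"
  shows "(\<Sum>m | m \<in> M \<and> (\<forall>i\<in>I. e m i mod (CARD('a) - 1) = u i mod (CARD('a) - 1)). c m) = 0"
proof -
  define N where "N = CARD('a) - 1"
  have N: "N \<ge> 1"
    using two_le_card[where 'a='a] by (simp add: N_def)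
  let ?P = "I \<rightarrow>\<^sub>E UNIV - {0 :: 'a}"
  let ?same = "\<lambda>m. \<forall>i\<in>I. e m i mod N = u i mod N"
  have orth: "(\<Sum>x\<in>?P. \<Prod>i\<in>I. x i ^ (e m i + (N - 1) * u i)) =
      (if ?same m then (-1) ^ card I else 0)" for m
  proof -
    have "(\<Sum>x\<in>?P. \<Prod>i\<in>I. x i ^ (e m i + (N - 1) * u i)) =
        (\<Prod>i\<in>I. \<Sum>t\<in>UNIV - {0 :: 'a}. t ^ (e m i + (N - 1) * u i))"
      by (rule prod_sum_PiE[symmetric]) (use fin in auto)
    also have "\<dots> = (\<Prod>i\<in>I. if e m i mod N = u i mod N then -1 else 0)"
      by (intro prod.cong refl) (simp only: sum_power_nonzero dvd_add_mult_pred_iff[OF N] flip: N_def)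
    also have "\<dots> = (if ?same m then (-1) ^ card I else 0)"
      using fin by (auto simp: prod_zero)
    finally show ?thesis .
  qed
  have "0 = (\<Sum>x\<in>?P. (\<Prod>i\<in>I. x i ^ ((N - 1) * u i)) * (\<Sum>m\<in>M. c m * (\<Prod>i\<in>I. x i ^ e m i)))"
    by (rule sym, rule sum.neutral, intro ballI) (subst zero, auto simp: PiE_def Pi_def)
  also have "\<dots> = (\<Sum>x\<in>?P. \<Sum>m\<in>M. c m * (\<Prod>i\<in>I. x i ^ (e m i + (N - 1) * u i)))"
    by (simp add: sum_distrib_left power_add prod.distrib mult_ac)
  also have "\<dots> = (\<Sum>m\<in>M. c m * (\<Sum>x\<in>?P. \<Prod>i\<in>I. x i ^ (e m i + (N - 1) * u i)))"
    by (subst sum.swap) (simp add: sum_distrib_left)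
  also have "\<dots> = (\<Sum>m\<in>M. if ?same m then (-1) ^ card I * c m else 0)"
    by (intro sum.cong refl) (simp add: orth del: One_nat_def)
  also have "\<dots> = (-1) ^ card I * (\<Sum>m | m \<in> M \<and> ?same m. c m)"
    using fin by (auto simp: sum.inter_filter sum_distrib_left intro!: sum.cong)
  finally show ?thesis
    by (simp add: N_def)
qed

section \<open>Evaluation and degree of polynomials\<close>

definition mon_eval :: "(nat \<Rightarrow>\<^sub>0 nat) \<Rightarrow> (nat \<Rightarrow> 'a::comm_ring_1) \<Rightarrow> 'a" where
  "mon_eval m x = (\<Prod>i\<in>Poly_Mapping.keys m. x i ^ Poly_Mapping.lookup m i)"

lemma mon_eval_superset:
  assumes "finite A" "Poly_Mapping.keys m \<subseteq> A"
  shows "mon_eval m x = (\<Prod>i\<in>A. x i ^ Poly_Mapping.lookup m i)"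
  unfolding mon_eval_def
  by (rule prod.mono_neutral_left) (use assms in \<open>auto simp: in_keys_iff\<close>)

lemma mon_degree_superset:
  assumes "finite A" "Poly_Mapping.keys m \<subseteq> A"
  shows "mon_degree m = (\<Sum>i\<in>A. Poly_Mapping.lookup m i)"
  unfolding mon_degree_def
  by (rule sum.mono_neutral_left) (use assms in \<open>auto simp: in_keys_iff\<close>)

lemma mon_eval_add: "mon_eval (a + b) x = mon_eval a x * mon_eval b x"
proof -
  let ?A = "Poly_Mapping.keys a \<union> Poly_Mapping.keys b"
  have "mon_eval m x = (\<Prod>i\<in>?A. x i ^ Poly_Mapping.lookup m i)"
    if "Poly_Mapping.keys m \<subseteq> ?A" for m
    using that by (intro mon_eval_superset) auto
  then show ?thesis
    using keys_add[of a b] by (simp add: lookup_add power_add prod.distrib)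
qed

lemma mon_degree_add: "mon_degree (a + b) = mon_degree a + mon_degree b"
proof -
  let ?A = "Poly_Mapping.keys a \<union> Poly_Mapping.keys b"
  have "mon_degree m = (\<Sum>i\<in>?A. Poly_Mapping.lookup m i)"
    if "Poly_Mapping.keys m \<subseteq> ?A" for m
    using that by (intro mon_degree_superset) auto
  then show ?thesis
    using keys_add[of a b] by (simp add: lookup_add sum.distrib)
qed

lemma mon_degree_single [simp]: "mon_degree (Poly_Mapping.single i k) = k"
  by (auto simp: mon_degree_def)

lemma mon_degree_eq_0_iff: "mon_degree m = 0 \<longleftrightarrow> m = 0"
  by (auto simp: mon_degree_def in_keys_iff intro!: poly_mapping_eqI)

lemma mpol_expand: "p = (\<Sum>m\<in>Poly_Mapping.keys p. Poly_Mapping.single m (Poly_Mapping.lookup p m))"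
  for p :: "'b \<Rightarrow>\<^sub>0 'a::comm_monoid_add"
proof (rule poly_mapping_eqI)
  fix k
  show "Poly_Mapping.lookup p k = Poly_Mapping.lookup
      (\<Sum>m\<in>Poly_Mapping.keys p. Poly_Mapping.single m (Poly_Mapping.lookup p m)) k"
    by (simp add: lookup_sum lookup_single when_def in_keys_iff)
qed

lemma mpol_mult_expand:
  fixes p h :: "'a::comm_ring_1 mpol"
  shows "p * h = (\<Sum>a\<in>Poly_Mapping.keys p. \<Sum>b\<in>Poly_Mapping.keys h.
    Poly_Mapping.single (a + b) (Poly_Mapping.lookup p a * Poly_Mapping.lookup h b))"
  by (subst (1) mpol_expand[of p], subst (1) mpol_expand[of h])
    (simp add: sum_product mult_single)

lemma mpol_eval_superset:
  assumes "finite M" "Poly_Mapping.keys p \<subseteq> M"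
  shows "mpol_eval p x = (\<Sum>m\<in>M. Poly_Mapping.lookup p m * mon_eval m x)"
  unfolding mpol_eval_def mon_eval_def[symmetric]
  by (rule sum.mono_neutral_left) (use assms in \<open>auto simp: in_keys_iff\<close>)

lemma mpol_eval_add: "mpol_eval (p + r) x = mpol_eval p x + mpol_eval r x"
proof -
  let ?M = "Poly_Mapping.keys p \<union> Poly_Mapping.keys r"
  have "mpol_eval g x = (\<Sum>m\<in>?M. Poly_Mapping.lookup g m * mon_eval m x)"
    if "Poly_Mapping.keys g \<subseteq> ?M" for g
    using that by (intro mpol_eval_superset) auto
  then show ?thesis
    using keys_add[of p r] by (simp add: lookup_add distrib_right sum.distrib)
qed

lemma mpol_eval_0 [simp]: "mpol_eval 0 x = 0"
  by (simp add: mpol_eval_def)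

lemma mpol_eval_sum: "mpol_eval (\<Sum>i\<in>A. f i) x = (\<Sum>i\<in>A. mpol_eval (f i) x)"
  by (induction A rule: infinite_finite_induct) (auto simp: mpol_eval_add)

lemma mpol_eval_single: "mpol_eval (Poly_Mapping.single m c) x = c * mon_eval m x"
  by (subst mpol_eval_superset[of "{m}"]) auto

lemma mpol_eval_mult: "mpol_eval (p * r) x = mpol_eval p x * mpol_eval r x"
proof -
  have "mpol_eval (p * r) x = (\<Sum>a\<in>Poly_Mapping.keys p. \<Sum>b\<in>Poly_Mapping.keys r.
      (Poly_Mapping.lookup p a * mon_eval a x) * (Poly_Mapping.lookup r b * mon_eval b x))"
    by (simp add: mpol_mult_expand mpol_eval_sum mpol_eval_single mon_eval_add mult_ac)
  also have "\<dots> = mpol_eval p x * mpol_eval r x"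
    by (simp add: mpol_eval_def mon_eval_def sum_product)
  finally show ?thesis .
qed

lemma mpol_eval_1 [simp]: "mpol_eval 1 x = 1"
  by (simp add: mpol_eval_def)

lemma mpol_eval_prod: "mpol_eval (\<Prod>i\<in>A. f i) x = (\<Prod>i\<in>A. mpol_eval (f i) x)"
  by (induction A rule: infinite_finite_induct) (auto simp: mpol_eval_mult)

lemma tvar_power: "tvar i ^ k = Poly_Mapping.single (Poly_Mapping.single i k) 1"
  by (induction k) (simp_all add: tvar_def mult_single flip: single_add)

lemma mpol_eval_tvar_power_diff:
  "mpol_eval (tvar i ^ k - tvar j ^ k) x = x i ^ k - x j ^ k"
proof -
  have "mpol_eval (tvar i ^ k - tvar j ^ k) x + mpol_eval (tvar j ^ k) x = mpol_eval (tvar i ^ k) x"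
    by (simp flip: mpol_eval_add)
  moreover have "mpol_eval (tvar l ^ k) x = x l ^ k" for l
    by (simp add: tvar_power mpol_eval_single mon_eval_def)
  ultimately show ?thesis
    by (simp add: algebra_simps)
qed

lemma mpol_eval_cong:
  assumes "p \<in> carrier (poly_ring s)" "\<And>i. i \<in> {1..s} \<Longrightarrow> x i = x' i"
  shows "mpol_eval p x = mpol_eval p x'"
  unfolding mpol_eval_def
  by (intro sum.cong prod.cong arg_cong2[where f = "(*)"] refl)
    (use assms in \<open>force simp: poly_ring_def\<close>)

definition has_degree :: "nat \<Rightarrow> 'a::comm_ring_1 mpol \<Rightarrow> bool" where
  "has_degree d p \<longleftrightarrow> (\<forall>m\<in>Poly_Mapping.keys p. mon_degree m = d)"

lemma homogeneous_iff: "homogeneous p \<longleftrightarrow> (\<exists>d. has_degree d p)"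
  by (simp add: homogeneous_def has_degree_def)

lemma has_degree_mult: "has_degree d p \<Longrightarrow> has_degree d' r \<Longrightarrow> has_degree (d + d') (p * r)"
  using keys_mult[of p r] by (fastforce simp: has_degree_def mon_degree_add)

lemma has_degree_1: "has_degree 0 1"
  by (simp add: has_degree_def mon_degree_def)

lemma homogeneous_prod: "(\<And>i. i \<in> A \<Longrightarrow> homogeneous (f i)) \<Longrightarrow> homogeneous (\<Prod>i\<in>A. f i)"
proof (induction A rule: infinite_finite_induct)
  case (insert a A)
  then have "homogeneous (f a)" "homogeneous (\<Prod>i\<in>A. f i)"
    by auto
  then obtain d d' where "has_degree d (f a)" "has_degree d' (\<Prod>i\<in>A. f i)"
    by (auto simp: homogeneous_iff)
  then show ?case
    using insert.hyps has_degree_mult[of d "f a" d'] by (auto simp: homogeneous_iff)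
qed (use has_degree_1 in \<open>auto simp: homogeneous_iff\<close>)

lemma has_degree_diff: "has_degree d p \<Longrightarrow> has_degree d r \<Longrightarrow> has_degree d (p - r)"
  unfolding has_degree_def by (metis diff_zero in_keys_iff lookup_minus)

lemma has_degree_single: "mon_degree m = d \<Longrightarrow> has_degree d (Poly_Mapping.single m c)"
  by (auto simp: has_degree_def)

text \<open>
  The comparison of coefficients behind graded Nakayama: at a monomial \<open>m\<close> none of whose proper
  divisors occurs in \<open>h\<close>, a multiple of \<open>h\<close> looks like a scalar multiple of \<open>h\<close>.
\<close>

lemma lookup_mult_constant_coeff:
  fixes p h :: "'a::comm_ring_1 mpol"
  assumes "\<And>a b. m = a + b \<Longrightarrow> a \<noteq> 0 \<Longrightarrow> Poly_Mapping.lookup h b = 0"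
  shows "Poly_Mapping.lookup (p * h) m = Poly_Mapping.lookup p 0 * Poly_Mapping.lookup h m"
proof -
  have "Poly_Mapping.lookup (p * h) m = (\<Sum>a\<in>Poly_Mapping.keys p. \<Sum>b\<in>Poly_Mapping.keys h.
      if a + b = m then Poly_Mapping.lookup p a * Poly_Mapping.lookup h b else 0)"
    by (simp add: mpol_mult_expand lookup_sum lookup_single when_def)
  also have "\<dots> = (\<Sum>a\<in>Poly_Mapping.keys p. \<Sum>b\<in>Poly_Mapping.keys h.
      if a = 0 \<and> b = m then Poly_Mapping.lookup p a * Poly_Mapping.lookup h b else 0)"
    by (intro sum.cong refl) (use assms in auto)
  also have "\<dots> = (\<Sum>a\<in>Poly_Mapping.keys p. if a = 0 then Poly_Mapping.lookup p a * Poly_Mapping.lookup h m else 0)"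
    by (intro sum.cong refl) (auto simp: in_keys_iff)
  also have "\<dots> = Poly_Mapping.lookup p 0 * Poly_Mapping.lookup h m"
    by (auto simp: in_keys_iff)
  finally show ?thesis .
qed

section \<open>Ideals of the polynomial ring\<close>

lemma poly_ring_simps [simp]:
  "a \<oplus>\<^bsub>poly_ring s\<^esub> b = a + b" "a \<otimes>\<^bsub>poly_ring s\<^esub> b = a * b"
  "\<zero>\<^bsub>poly_ring s\<^esub> = 0" "\<one>\<^bsub>poly_ring s\<^esub> = 1"
  by (simp_all add: poly_ring_def)

lemma poly_ring_ring: "ring (poly_ring s)"
  using poly_ring_cring by (rule cring.axioms)

lemma poly_ring_add_closed:
  "p \<in> carrier (poly_ring s) \<Longrightarrow> r \<in> carrier (poly_ring s) \<Longrightarrow> p + r \<in> carrier (poly_ring s)"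
  using ring.ring_simprules(1)[OF poly_ring_ring, of p s r] by simp

lemma poly_ring_mult_closed:
  "p \<in> carrier (poly_ring s) \<Longrightarrow> r \<in> carrier (poly_ring s) \<Longrightarrow> p * r \<in> carrier (poly_ring s)"
  using ring.ring_simprules(5)[OF poly_ring_ring, of p s r] by simp

lemma poly_ring_uminus_closed: "p \<in> carrier (poly_ring s) \<Longrightarrow> - p \<in> carrier (poly_ring s)"
  by (simp add: poly_ring_def in_keys_iff)

lemma poly_ring_diff_closed:
  "p \<in> carrier (poly_ring s) \<Longrightarrow> r \<in> carrier (poly_ring s) \<Longrightarrow> p - r \<in> carrier (poly_ring s)"
  using poly_ring_add_closed[of p s "- r"] poly_ring_uminus_closed[of r s] by simp

lemma poly_ring_0_closed: "0 \<in> carrier (poly_ring s)"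
  and poly_ring_1_closed: "1 \<in> carrier (poly_ring s)"
  by (simp_all add: poly_ring_def)

lemma poly_ring_single_closed:
  "Poly_Mapping.keys m \<subseteq> {1..s} \<Longrightarrow> Poly_Mapping.single m c \<in> carrier (poly_ring s)"
  by (simp add: poly_ring_def)

lemma poly_ring_sum_closed:
  "(\<And>i. i \<in> A \<Longrightarrow> f i \<in> carrier (poly_ring s)) \<Longrightarrow> (\<Sum>i\<in>A. f i) \<in> carrier (poly_ring s)"
  by (induction A rule: infinite_finite_induct) (auto intro: poly_ring_add_closed poly_ring_0_closed)

lemma poly_ring_prod_closed:
  "(\<And>i. i \<in> A \<Longrightarrow> f i \<in> carrier (poly_ring s)) \<Longrightarrow> (\<Prod>i\<in>A. f i) \<in> carrier (poly_ring s)"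
  by (induction A rule: infinite_finite_induct) (auto intro: poly_ring_mult_closed poly_ring_1_closed)

lemma poly_ring_idealI:
  fixes I :: "'a::comm_ring_1 mpol set"
  assumes sub: "I \<subseteq> carrier (poly_ring s)" and zero: "0 \<in> I"
    and add: "\<And>a b. a \<in> I \<Longrightarrow> b \<in> I \<Longrightarrow> a + b \<in> I"
    and mult: "\<And>p a. p \<in> carrier (poly_ring s) \<Longrightarrow> a \<in> I \<Longrightarrow> p * a \<in> I"
  shows "ideal I (poly_ring s)"
proof -
  interpret ring "poly_ring s :: 'a mpol ring"
    by (rule poly_ring_ring)
  have "- a \<in> I" if "a \<in> I" for a
    using mult[of "-1" a] that poly_ring_uminus_closed[OF poly_ring_1_closed, of s] by simp
  moreover have "\<ominus>\<^bsub>poly_ring s\<^esub> a = - a" if "a \<in> I" for a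
    using that sub by (intro minus_equality) (auto intro: poly_ring_uminus_closed)
  moreover have "a * p \<in> I" if "p \<in> carrier (poly_ring s)" "a \<in> I" for p a
    using mult[OF that] by (simp add: mult.commute)
  ultimately show ?thesis
    using sub zero add mult by (intro idealI add.subgroupI ring_axioms) auto
qed

lemma
  assumes "ideal I (poly_ring s)"
  shows poly_ring_ideal_zero: "0 \<in> I"
    and poly_ring_ideal_add: "a \<in> I \<Longrightarrow> b \<in> I \<Longrightarrow> a + b \<in> I"
    and poly_ring_ideal_mult: "p \<in> carrier (poly_ring s) \<Longrightarrow> a \<in> I \<Longrightarrow> p * a \<in> I"
  using additive_subgroup.zero_closed[OF ideal.axioms(1)[OF assms]]
    additive_subgroup.a_closed[OF ideal.axioms(1)[OF assms], of a b]
    ideal.I_l_closed[OF assms, of a p]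
  by simp_all

lemma poly_ring_ideal_sum:
  assumes "ideal I (poly_ring s)" "\<And>i. i \<in> A \<Longrightarrow> f i \<in> I"
  shows "(\<Sum>i\<in>A. f i) \<in> I"
  using assms(2)
  by (induction A rule: infinite_finite_induct)
    (auto intro: poly_ring_ideal_zero[OF assms(1)] poly_ring_ideal_add[OF assms(1)])

lemmas poly_ring_Idl_ideal = ring.genideal_ideal[OF poly_ring_ring]
lemmas poly_ring_Idl_self = ring.genideal_self[OF poly_ring_ring]
lemmas poly_ring_Idl_minimal = ring.genideal_minimal[OF poly_ring_ring]

lemma poly_ring_Idl_image:
  fixes f :: "nat \<Rightarrow> 'a::comm_ring_1 mpol"
  assumes "finite A" and f: "f ` A \<subseteq> carrier (poly_ring s)"
  shows "Idl\<^bsub>poly_ring s\<^esub> (f ` A) =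
    {(\<Sum>i\<in>A. p i * f i) | p. \<forall>i\<in>A. p i \<in> carrier (poly_ring s)}" (is "_ = ?L")
proof
  show "Idl\<^bsub>poly_ring s\<^esub> (f ` A) \<subseteq> ?L"
  proof (intro poly_ring_Idl_minimal poly_ring_idealI)
    show "?L \<subseteq> carrier (poly_ring s)"
      using f by (auto intro!: poly_ring_sum_closed poly_ring_mult_closed)
    show "0 \<in> ?L"
      by (auto intro!: exI[of _ "\<lambda>_. 0"] poly_ring_0_closed)
  next
    fix a b assume "a \<in> ?L" "b \<in> ?L"
    then obtain p r where "a = (\<Sum>i\<in>A. p i * f i)" "b = (\<Sum>i\<in>A. r i * f i)"
      "\<forall>i\<in>A. p i \<in> carrier (poly_ring s)" "\<forall>i\<in>A. r i \<in> carrier (poly_ring s)"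
      by blast
    then show "a + b \<in> ?L"
      by (auto intro!: exI[of _ "\<lambda>i. p i + r i"] poly_ring_add_closed
        simp: distrib_right sum.distrib)
  next
    fix c a :: "'a mpol" assume c: "c \<in> carrier (poly_ring s)" and "a \<in> ?L"
    then obtain p where "a = (\<Sum>i\<in>A. p i * f i)" "\<forall>i\<in>A. p i \<in> carrier (poly_ring s)"
      by blast
    then show "c * a \<in> ?L"
      using c by (auto intro!: exI[of _ "\<lambda>i. c * p i"] poly_ring_mult_closed
        simp: sum_distrib_left mult.assoc)
  next
    show "f ` A \<subseteq> ?L"
    proof
      fix g assume "g \<in> f ` A"
      then obtain k where k: "k \<in> A" "g = f k"
        by blast
      then have "g = (\<Sum>i\<in>A. (if i = k then 1 else 0) * f i)"
        using assms(1) by (simp add: if_distrib[of "\<lambda>c. c * _"] cong: if_cong)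
      then show "g \<in> ?L"
        by (intro CollectI exI[of _ "\<lambda>i. if i = k then 1 else 0"])
          (auto intro: poly_ring_0_closed poly_ring_1_closed)
    qed
  qed
  show "?L \<subseteq> Idl\<^bsub>poly_ring s\<^esub> (f ` A)"
    using poly_ring_Idl_self[OF f]
    by (auto intro!: poly_ring_ideal_sum poly_ring_ideal_mult poly_ring_Idl_ideal[OF f])
qed

section \<open>Vanishing ideals and points of toric sets\<close>

text \<open>
  Vanishing at all representatives of the points of \<open>X\<close> is preserved by sums and multiples, so it
  passes from the homogeneous generators to inhomogeneous elements of the ideal.
\<close>

lemma vanishing_idealD:
  assumes "p \<in> vanishing_ideal s X"
  shows "p \<in> carrier (poly_ring s)" "vanishes_on p X"
proof -
  let ?J = "{p \<in> carrier (poly_ring s). vanishes_on p X}"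
  have "ideal ?J (poly_ring s)"
    by (rule poly_ring_idealI)
      (auto simp: vanishes_on_def mpol_eval_add mpol_eval_mult
        intro: poly_ring_0_closed poly_ring_add_closed poly_ring_mult_closed)
  then have "vanishing_ideal s X \<subseteq> ?J"
    unfolding vanishing_ideal_def by (rule poly_ring_Idl_minimal) auto
  then show "p \<in> carrier (poly_ring s)" "vanishes_on p X"
    using assms by auto
qed

lemma vanishing_idealI:
  assumes "p \<in> carrier (poly_ring s)" "homogeneous p" "vanishes_on p X"
  shows "p \<in> vanishing_ideal s X"
  unfolding vanishing_ideal_def using assms by (intro subsetD[OF poly_ring_Idl_self]) auto

lemma vanishing_ideal_subsetI:
  assumes "ideal I (poly_ring s)"
    and "\<And>p. p \<in> carrier (poly_ring s) \<Longrightarrow> homogeneous p \<Longrightarrow> vanishes_on p X \<Longrightarrow> p \<in> I"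
  shows "vanishing_ideal s X \<subseteq> I"
  unfolding vanishing_ideal_def using assms by (intro poly_ring_Idl_minimal) auto

lemma ideal_vanishing_ideal: "ideal (vanishing_ideal s X) (poly_ring s)"
  unfolding vanishing_ideal_def by (intro poly_ring_Idl_ideal) auto

lemma mem_proj_point_iff:
  assumes "s \<ge> 1" "\<forall>i\<in>{1..s}. x i \<noteq> 0"
  shows "z \<in> proj_point s x \<longleftrightarrow>
    z \<in> {1..s} \<rightarrow>\<^sub>E UNIV \<and> (\<exists>c. c \<noteq> 0 \<and> (\<forall>i\<in>{1..s}. z i = c * x i))"
  using assms by (auto simp: proj_point_def proportional_def nonzero_vecs_def intro!: bexI[of _ 1])

lemma proj_point_eqI:
  assumes s: "s \<ge> 1" and x: "\<forall>i\<in>{1..s}. x i \<noteq> 0"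
    and c: "c \<noteq> 0" "\<forall>i\<in>{1..s}. x i = c * z i"
  shows "proj_point s x = proj_point s z"
proof -
  have z: "\<forall>i\<in>{1..s}. z i \<noteq> 0"
    using x c by auto
  have "w \<in> proj_point s x \<longleftrightarrow> w \<in> proj_point s z" for w
  proof -
    have "(\<exists>d. d \<noteq> 0 \<and> (\<forall>i\<in>{1..s}. w i = d * x i)) \<longleftrightarrow> (\<exists>d. d \<noteq> 0 \<and> (\<forall>i\<in>{1..s}. w i = d * z i))"
    proof (intro iffI; elim exE conjE)
      fix d assume "d \<noteq> 0" "\<forall>i\<in>{1..s}. w i = d * x i"
      then show "\<exists>d. d \<noteq> 0 \<and> (\<forall>i\<in>{1..s}. w i = d * z i)"
        using c by (intro exI[of _ "d * c"]) auto
    next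
      fix d assume "d \<noteq> 0" "\<forall>i\<in>{1..s}. w i = d * z i"
      then show "\<exists>d. d \<noteq> 0 \<and> (\<forall>i\<in>{1..s}. w i = d * x i)"
        using c by (intro exI[of _ "d / c"]) auto
    qed
    then show ?thesis
      by (simp only: mem_proj_point_iff[OF s x] mem_proj_point_iff[OF s z])
  qed
  then show ?thesis
    by blast
qed

lemma vanishes_on_proj_point:
  assumes "s \<ge> 1" "\<forall>i\<in>{1..s}. x i \<noteq> 0" "proj_point s x \<in> X"
    and "p \<in> carrier (poly_ring s)" "vanishes_on p X"
  shows "mpol_eval p x = 0"
proof -
  have "restrict x {1..s} \<in> proj_point s x"
    using assms by (subst mem_proj_point_iff) (auto intro: exI[of _ 1])
  then have "mpol_eval p (restrict x {1..s}) = 0"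
    using assms by (auto simp: vanishes_on_def)
  then show ?thesis
    using mpol_eval_cong[OF assms(4), of x "restrict x {1..s}"] by simp
qed

definition monomial_map :: "nat \<Rightarrow> (nat \<Rightarrow> nat \<Rightarrow>\<^sub>0 nat) \<Rightarrow> (nat \<Rightarrow> 'a::comm_ring_1) \<Rightarrow> nat \<Rightarrow> 'a" where
  "monomial_map n v x j = (\<Prod>i\<in>{1..n}. x i ^ Poly_Mapping.lookup (v j) i)"

lemma monomial_map_nonzero:
  fixes x :: "nat \<Rightarrow> 'a::field"
  shows "\<forall>i\<in>{1..n}. x i \<noteq> 0 \<Longrightarrow> monomial_map n v x j \<noteq> 0"
  by (simp add: monomial_map_def)

lemma proj_torus_eq:
  "s \<ge> 1 \<Longrightarrow> proj_torus s = {proj_point s x | x. \<forall>i\<in>{1..s}. x i \<noteq> 0}"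
  unfolding proj_torus_def using proj_point_in_proj_space by blast

lemma toric_set_eq:
  assumes "s \<ge> 1"
  shows "toric_set n s v = {proj_point s (monomial_map n v x) | x. \<forall>i\<in>{1..n}. x i \<noteq> 0}"
proof -
  have "proj_point s (monomial_map n v x) \<in> proj_space s" if "\<forall>i\<in>{1..n}. x i \<noteq> 0"
    for x :: "nat \<Rightarrow> 'a"
    using assms monomial_map_nonzero[OF that] by (intro proj_point_in_proj_space) auto
  then show ?thesis
    unfolding toric_set_def monomial_map_def[abs_def] by blast
qed

lemma toric_set_subset_proj_torus:
  assumes "s \<ge> 1"
  shows "toric_set n s v \<subseteq> proj_torus s"
  unfolding toric_set_eq[OF assms] proj_torus_eq[OF assms] using monomial_map_nonzero by blast

lemma mon_eval_monomial_map:
  assumes "Poly_Mapping.keys m \<subseteq> {1..s}"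
  shows "mon_eval m (monomial_map n v x) =
    (\<Prod>i\<in>{1..n}. x i ^ (\<Sum>j\<in>{1..s}. Poly_Mapping.lookup m j * Poly_Mapping.lookup (v j) i))"
proof -
  have "mon_eval m (monomial_map n v x) =
      (\<Prod>j\<in>{1..s}. \<Prod>i\<in>{1..n}. x i ^ (Poly_Mapping.lookup m j * Poly_Mapping.lookup (v j) i))"
    using assms
    by (subst mon_eval_superset[of "{1..s}"])
      (simp_all add: monomial_map_def prod_power_distrib mult.commute flip: power_mult)
  also have "\<dots> = (\<Prod>i\<in>{1..n}. \<Prod>j\<in>{1..s}.
      x i ^ (Poly_Mapping.lookup m j * Poly_Mapping.lookup (v j) i))"
    by (rule prod.swap)
  finally show ?thesis
    by (simp add: power_sum)
qed

section \<open>Pure powers of low degree in the vanishing ideal\<close>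

text \<open>
  This is where the vectors \<open>v\<^sub>j\<close> being distinct and having entries in \<open>{0, 1}\<close> enters.  If \<open>m\<close> has
  degree \<open>b < N\<close>, the exponents \<open>\<Sum>\<^sub>j m\<^sub>j v\<^sub>j\<^sub>i\<close> and \<open>b v\<^sub>k\<^sub>i\<close> are at most \<open>b\<close>, so that congruence modulo
  \<open>N\<close> is equality.  Where \<open>v\<^sub>k\<^sub>i\<close> is \<open>0\<close>, every \<open>v\<^sub>j\<close> with \<open>m\<^sub>j \<noteq> 0\<close> must have the entry \<open>0\<close>; where it is
  \<open>1\<close>, the sum attains its maximal value \<open>b = \<Sum>\<^sub>j m\<^sub>j\<close>, and every such \<open>v\<^sub>j\<close> must have the entry \<open>1\<close>.
  Hence \<open>v\<^sub>j = v\<^sub>k\<close>, and \<open>j = k\<close>.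
\<close>

lemma pure_power_unique_in_exponent_class:
  fixes v :: "nat \<Rightarrow> nat \<Rightarrow>\<^sub>0 nat"
  assumes inj: "inj_on v {1..s}"
    and supp: "\<And>j. j \<in> {1..s} \<Longrightarrow> Poly_Mapping.keys (v j) \<subseteq> {1..n}"
    and le1: "\<And>j i. j \<in> {1..s} \<Longrightarrow> Poly_Mapping.lookup (v j) i \<le> 1"
    and k: "k \<in> {1..s}"
    and m: "Poly_Mapping.keys m \<subseteq> {1..s}" "mon_degree m = b" "b < N"
    and eq: "\<And>i. i \<in> {1..n} \<Longrightarrow>
      (\<Sum>j\<in>{1..s}. Poly_Mapping.lookup m j * Poly_Mapping.lookup (v j) i) mod N =
        b * Poly_Mapping.lookup (v k) i mod N"
  shows "m = Poly_Mapping.single k b"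
proof -
  have b: "b = (\<Sum>j\<in>{1..s}. Poly_Mapping.lookup m j)"
    using m mon_degree_superset[of "{1..s}" m] by simp
  have eq': "(\<Sum>j\<in>{1..s}. Poly_Mapping.lookup m j * Poly_Mapping.lookup (v j) i) =
      b * Poly_Mapping.lookup (v k) i" if "i \<in> {1..n}" for i
  proof -
    have "(\<Sum>j\<in>{1..s}. Poly_Mapping.lookup m j * Poly_Mapping.lookup (v j) i) \<le> b"
      unfolding b using le1 by (intro sum_mono) (metis mult.right_neutral mult_le_mono2)
    moreover have "b * Poly_Mapping.lookup (v k) i \<le> b"
      using le1[OF k] by (metis mult.right_neutral mult_le_mono2)
    ultimately show ?thesis
      using eq[OF that] m(3) by (simp only: mod_less le_less_trans)
  qed
  have only_k: "j = k" if j: "j \<in> {1..s}" "Poly_Mapping.lookup m j \<noteq> 0" for j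
  proof -
    have "Poly_Mapping.lookup (v j) i = Poly_Mapping.lookup (v k) i" for i
    proof (cases "i \<in> {1..n}")
      case False
      then show ?thesis
        using supp j k by (metis in_keys_iff subsetD)
    next
      case True
      consider "Poly_Mapping.lookup (v k) i = 0" | "Poly_Mapping.lookup (v k) i = 1"
        using le1[OF k, of i] by linarith
      then show ?thesis
      proof cases
        case 1
        show ?thesis
        proof -
          have "(\<Sum>j\<in>{1..s}. Poly_Mapping.lookup m j * Poly_Mapping.lookup (v j) i) = 0"
            using eq'[OF True] 1 by simp
          then have "Poly_Mapping.lookup m j * Poly_Mapping.lookup (v j) i = 0"
            unfolding sum_eq_0_iff[OF finite_atLeastAtMost] using j(1) by (rule bspec)
          then show ?thesis
            using 1 j(2) by simp
        qed
      next
        case 2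
        \<comment> \<open>The difference between the maximal value \<open>\<Sum>\<^sub>j m\<^sub>j\<close> and the exponent is a sum of terms
          \<open>m\<^sub>j (1 - v\<^sub>j\<^sub>i)\<close>, all of which are then zero.\<close>
        have "(\<Sum>j\<in>{1..s}. Poly_Mapping.lookup m j * (1 - Poly_Mapping.lookup (v j) i)) =
            (\<Sum>j\<in>{1..s}. Poly_Mapping.lookup m j - Poly_Mapping.lookup m j * Poly_Mapping.lookup (v j) i)"
          by (simp add: diff_mult_distrib2)
        also have "\<dots> = b - b * Poly_Mapping.lookup (v k) i"
          unfolding eq'[OF True, symmetric] unfolding b
          using le1 by (intro sum_subtractf_nat) (metis mult.right_neutral mult_le_mono2)
        also have "\<dots> = 0"
          using 2 by simp
        finally have "\<forall>j\<in>{1..s}. Poly_Mapping.lookup m j * (1 - Poly_Mapping.lookup (v j) i) = 0"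
          unfolding sum_eq_0_iff[OF finite_atLeastAtMost] .
        then have "Poly_Mapping.lookup m j * (1 - Poly_Mapping.lookup (v j) i) = 0"
          using j(1) by (rule bspec)
        then have "1 - Poly_Mapping.lookup (v j) i = 0"
          using j(2) by simp
        then show ?thesis
          using 2 le1[OF j(1), of i] by simp
      qed
    qed
    then have "v j = v k"
      by (intro poly_mapping_eqI) simp
    then show ?thesis
      using inj j(1) k by (metis inj_onD)
  qed
  have other: "Poly_Mapping.lookup m j = 0" if "j \<noteq> k" for j
    using only_k[of j] that m(1) by (metis in_keys_iff subsetD)
  then have "Poly_Mapping.keys m \<subseteq> {k}"
    by (auto simp: in_keys_iff)
  then have "b = Poly_Mapping.lookup m k"
    using m(2) mon_degree_superset[of "{k}" m] by simp
  then show ?thesis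
    using other by (intro poly_mapping_eqI) (auto simp: lookup_single when_def)
qed

text \<open>
  If \<open>t\<^sub>k\<^sup>b\<close> occurs in \<open>p\<close>, then \<open>p\<close> has degree \<open>b\<close>.  After substituting the parameterization, \<open>t\<^sub>k\<^sup>b\<close> is
  then alone in its class of exponent vectors modulo \<open>q - 1\<close> among the monomials of \<open>p\<close>, so that its
  coefficient is the sum over that class and vanishes by orthogonality.
\<close>

lemma pure_power_coeff_zero:
  fixes p :: "'a::{finite,field} mpol" and v :: "nat \<Rightarrow> nat \<Rightarrow>\<^sub>0 nat"
  assumes s: "s \<ge> 1"
    and inj: "inj_on v {1..s}"
    and supp: "\<And>j. j \<in> {1..s} \<Longrightarrow> Poly_Mapping.keys (v j) \<subseteq> {1..n}"
    and le1: "\<And>j i. j \<in> {1..s} \<Longrightarrow> Poly_Mapping.lookup (v j) i \<le> 1"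
    and p: "p \<in> carrier (poly_ring s)" "homogeneous p" "vanishes_on p (toric_set n s v)"
    and k: "k \<in> {1..s}" and b: "b < CARD('a) - 1"
  shows "Poly_Mapping.lookup p (Poly_Mapping.single k b) = 0"
proof (rule ccontr)
  assume nz: "Poly_Mapping.lookup p (Poly_Mapping.single k b) \<noteq> 0"
  let ?N = "CARD('a) - 1"
  let ?e = "\<lambda>m i. \<Sum>j\<in>{1..s}. Poly_Mapping.lookup m j * Poly_Mapping.lookup (v j) i"
  have key: "Poly_Mapping.single k b \<in> Poly_Mapping.keys p"
    using nz by (simp add: in_keys_iff)
  then have deg: "mon_degree m = b" if "m \<in> Poly_Mapping.keys p" for m
    using p(2) that by (force simp: homogeneous_def)
  have supp_p: "Poly_Mapping.keys m \<subseteq> {1..s}" if "m \<in> Poly_Mapping.keys p" for m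
    using p(1) that by (auto simp: poly_ring_def)
  have zero: "(\<Sum>m\<in>Poly_Mapping.keys p. Poly_Mapping.lookup p m * (\<Prod>i\<in>{1..n}. x i ^ ?e m i)) = 0"
    if x: "\<forall>i\<in>{1..n}. x i \<noteq> 0" for x :: "nat \<Rightarrow> 'a"
  proof -
    have "mpol_eval p (monomial_map n v x) = 0"
      using x p s by (intro vanishes_on_proj_point[of s _ "toric_set n s v"])
        (auto simp: toric_set_eq monomial_map_nonzero)
    moreover have "(\<Sum>m\<in>Poly_Mapping.keys p. Poly_Mapping.lookup p m * mon_eval m (monomial_map n v x)) =
        (\<Sum>m\<in>Poly_Mapping.keys p. Poly_Mapping.lookup p m * (\<Prod>i\<in>{1..n}. x i ^ ?e m i))"
      by (intro sum.cong refl) (simp only: mon_eval_monomial_map[OF supp_p])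
    ultimately show ?thesis
      by (simp only: mpol_eval_superset[OF finite_keys order_refl])
  qed
  have "{m \<in> Poly_Mapping.keys p. \<forall>i\<in>{1..n}. ?e m i mod ?N = b * Poly_Mapping.lookup (v k) i mod ?N} =
      {Poly_Mapping.single k b}"
  proof (intro equalityI subsetI)
    fix m assume "m \<in> {m \<in> Poly_Mapping.keys p.
        \<forall>i\<in>{1..n}. ?e m i mod ?N = b * Poly_Mapping.lookup (v k) i mod ?N}"
    then have m: "m \<in> Poly_Mapping.keys p"
      and eq: "\<And>i. i \<in> {1..n} \<Longrightarrow> ?e m i mod ?N = b * Poly_Mapping.lookup (v k) i mod ?N"
      by blast+
    have "m = Poly_Mapping.single k b"
      using inj supp le1 k supp_p[OF m] deg[OF m] b eq by (rule pure_power_unique_in_exponent_class)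
    then show "m \<in> {Poly_Mapping.single k b}"
      by blast
  next
    fix m assume "m \<in> {Poly_Mapping.single k b}"
    then have "m = Poly_Mapping.single k b"
      by simp
    moreover have "?e (Poly_Mapping.single k b) i = b * Poly_Mapping.lookup (v k) i" for i
      using k by (simp add: lookup_single when_def if_distrib[of "\<lambda>c. c * _"] cong: if_cong)
    ultimately show "m \<in> {m \<in> Poly_Mapping.keys p.
        \<forall>i\<in>{1..n}. ?e m i mod ?N = b * Poly_Mapping.lookup (v k) i mod ?N}"
      using key by (simp del: One_nat_def)
  qed
  moreover have "(\<Sum>m | m \<in> Poly_Mapping.keys p \<and>
      (\<forall>i\<in>{1..n}. ?e m i mod ?N = b * Poly_Mapping.lookup (v k) i mod ?N). Poly_Mapping.lookup p m) = 0"
    using finite_keys finite_atLeastAtMost zero by (rule sum_coeffs_in_exponent_class)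
  ultimately have "(\<Sum>m\<in>{Poly_Mapping.single k b}. Poly_Mapping.lookup p m) = 0"
    by (simp only:)
  then show False
    using nz by simp
qed

section \<open>The binomials of the projective torus\<close>

abbreviation torus_binomial :: "nat \<Rightarrow> nat \<Rightarrow> nat \<Rightarrow> 'a::comm_ring_1 mpol" where
  "torus_binomial N s i \<equiv> tvar i ^ N - tvar s ^ N"

lemma has_degree_torus_binomial: "has_degree N (torus_binomial N s i)"
  by (simp add: tvar_power has_degree_diff has_degree_single)

lemma torus_binomial_closed:
  "s \<ge> 1 \<Longrightarrow> i \<in> {1..s} \<Longrightarrow> torus_binomial N s i \<in> carrier (poly_ring s)"
  unfolding tvar_power by (intro poly_ring_diff_closed poly_ring_single_closed) auto

lemma torus_binomial_vanishes_on_proj_torus: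
  fixes i s :: nat
  assumes s: "s \<ge> 1" and i: "i \<in> {1..s}"
  shows "vanishes_on (torus_binomial (CARD('a::{finite,field}) - 1) s i) (proj_torus s :: (nat \<Rightarrow> 'a) set set)"
  unfolding vanishes_on_def
proof (intro ballI)
  fix P and z :: "nat \<Rightarrow> 'a" assume "P \<in> proj_torus s" "z \<in> P"
  then obtain x c where "\<forall>j\<in>{1..s}. x j \<noteq> 0" "c \<noteq> 0" "\<forall>j\<in>{1..s}. z j = c * x j"
    using s by (auto simp: proj_torus_eq mem_proj_point_iff)
  then have "\<forall>j\<in>{1..s}. z j \<noteq> 0"
    by simp
  then show "mpol_eval (torus_binomial (CARD('a) - 1) s i) z = 0"
    using s i by (simp add: mpol_eval_tvar_power_diff power_card_minus_one del: One_nat_def)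
qed

lemma torus_binomial_in_vanishing_ideal:
  fixes X :: "(nat \<Rightarrow> 'a::{finite,field}) set set"
  assumes "s \<ge> 1" "i \<in> {1..s}" "X \<subseteq> proj_torus s"
  shows "torus_binomial (CARD('a) - 1) s i \<in> vanishing_ideal s X"
  using torus_binomial_vanishes_on_proj_torus[OF assms(1,2)] assms
  by (intro vanishing_idealI torus_binomial_closed)
    (auto simp: homogeneous_iff vanishes_on_def intro: has_degree_torus_binomial)

section \<open>Complete intersections\<close>

text \<open>
  Matrices are written as functions of indices in \<open>{1..n}\<close>, which is how the generators of a
  complete intersection are numbered.
\<close>

lemma square_left_inverse_is_right_inverse:
  fixes C H :: "nat \<Rightarrow> nat \<Rightarrow> 'a::field"
  assumes "\<And>i k. i \<in> {1..n} \<Longrightarrow> k \<in> {1..n} \<Longrightarrow> (\<Sum>j\<in>{1..n}. C i j * H j k) = of_bool (i = k)"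
    and "i \<in> {1..n}" "k \<in> {1..n}"
  shows "(\<Sum>j\<in>{1..n}. H i j * C j k) = of_bool (i = k)"
proof -
  have shift: "(\<Sum>j\<in>{1..n}. f j) = (\<Sum>j\<in>{0..<n}. f (Suc j))" for f :: "nat \<Rightarrow> 'a"
    by (rule sum.reindex_bij_witness[of _ Suc "\<lambda>j. j - 1"]) auto
  let ?M = "\<lambda>F. mat n n (\<lambda>(i, j). F (Suc i) (Suc j) :: 'a)"
  have prod: "(?M F * ?M G) $$ (i, k) = (\<Sum>j\<in>{1..n}. F (Suc i) j * G j (Suc k))"
    if "i < n" "k < n" for F G i k
    unfolding shift using that by (simp add: scalar_prod_def)
  have "?M C * ?M H = 1\<^sub>m n"
    by (rule eq_matI) (simp_all add: prod assms(1) del: index_mult_mat(1) One_nat_def)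
  then have "?M H * ?M C = 1\<^sub>m n"
    by (rule mat_mult_left_right_inverse[rotated 2]) auto
  moreover obtain i' k' where "i = Suc i'" "k = Suc k'" "i' < n" "k' < n"
    using assms(2,3) by (cases i; cases k) auto
  ultimately show ?thesis
    using prod[of i' k' H C] by (simp add: of_bool_def)
qed

lemma single_eq_add_obtains:
  fixes a b :: "nat \<Rightarrow>\<^sub>0 nat"
  assumes "Poly_Mapping.single k N = a + b" "a \<noteq> 0"
  obtains b' where "b = Poly_Mapping.single k b'" "b' < N"
proof -
  have sum: "Poly_Mapping.lookup a j + Poly_Mapping.lookup b j = (if j = k then N else 0)" for j
    using arg_cong[OF assms(1), of "\<lambda>m. Poly_Mapping.lookup m j"]
    by (simp add: lookup_add lookup_single when_def eq_commute)
  have "b = Poly_Mapping.single k (Poly_Mapping.lookup b k)"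
    using sum by (intro poly_mapping_eqI) (simp add: lookup_single when_def, metis add_is_0)
  moreover have "Poly_Mapping.lookup a k \<noteq> 0"
  proof
    assume "Poly_Mapping.lookup a k = 0"
    then have "Poly_Mapping.lookup a j = 0" for j
      using sum[of j] by (cases "j = k") auto
    then show False
      using assms(2) by (auto intro: poly_mapping_eqI)
  qed
  ultimately show thesis
    using sum[of k] by (intro that) auto
qed

lemma lookup_const_mult:
  "Poly_Mapping.lookup (Poly_Mapping.single 0 c * p) m = c * Poly_Mapping.lookup p m"
  for p :: "'a::comm_ring_1 mpol"
  by (simp add: map.rep_eq when_def in_keys_iff flip: mult_map_scale_conv_mult)

text \<open>
  Let \<open>h\<^sub>1, \<dots>, h\<^bsub>s-1\<^esub>\<close> be homogeneous generators of \<open>I(X)\<close> and write \<open>f\<^sub>i = \<Sum>\<^sub>j p\<^sub>i\<^sub>j h\<^sub>j\<close> for the binomials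
  \<open>f\<^sub>i = t\<^sub>i\<^sup>N - t\<^sub>s\<^sup>N\<close>.  No \<open>h\<^sub>j\<close> contains a pure power of degree below \<open>N\<close>, so at \<open>t\<^sub>k\<^sup>N\<close> only the constant
  term \<open>C\<^sub>i\<^sub>j\<close> of \<open>p\<^sub>i\<^sub>j\<close> meets the coefficient \<open>H\<^sub>j\<^sub>k\<close> of \<open>t\<^sub>k\<^sup>N\<close> in \<open>h\<^sub>j\<close>.  For \<open>k < s\<close> this says that \<open>C H\<close> is the
  identity matrix.  Since there are as many generators as binomials, \<open>C\<close> and \<open>H\<close> are square, and
  \<open>H C\<close> is the identity as well.  In particular no row of \<open>H\<close> is zero, so that every \<open>h\<^sub>j\<close> has degree
  \<open>N\<close>; comparing terms of degree \<open>N\<close> gives \<open>f\<^sub>i = \<Sum>\<^sub>j C\<^sub>i\<^sub>j h\<^sub>j\<close>, hence \<open>h\<^sub>j = \<Sum>\<^sub>i H\<^sub>j\<^sub>i f\<^sub>i\<close>.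
\<close>

lemma torus_ideal_if_complete_intersection:
  fixes v :: "nat \<Rightarrow> nat \<Rightarrow>\<^sub>0 nat" and X :: "(nat \<Rightarrow> 'a::{finite,field}) set set"
  defines "N \<equiv> CARD('a) - 1"
  assumes s: "s \<ge> 1"
    and inj: "inj_on v {1..s}"
    and supp: "\<And>j. j \<in> {1..s} \<Longrightarrow> Poly_Mapping.keys (v j) \<subseteq> {1..n}"
    and le1: "\<And>j i. j \<in> {1..s} \<Longrightarrow> Poly_Mapping.lookup (v j) i \<le> 1"
    and X: "X = toric_set n s v"
    and ci: "complete_intersection s (vanishing_ideal s X)"
  shows "vanishing_ideal s X = Idl\<^bsub>poly_ring s\<^esub> (torus_binomial N s ` {1..s-1})"
proof -
  let ?R = "poly_ring s" and ?A = "{1..s-1}" and ?I = "vanishing_ideal s X"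
  let ?F = "torus_binomial N s :: nat \<Rightarrow> 'a mpol"
  have N: "N \<ge> 1"
    using two_le_card[where 'a='a] by (simp add: N_def)
  have A: "i \<in> {1..s}" "i \<noteq> s" if "i \<in> ?A" for i
    using that s by auto
  obtain h where h: "\<And>i. i \<in> ?A \<Longrightarrow> h i \<in> carrier ?R" "\<And>i. i \<in> ?A \<Longrightarrow> homogeneous (h i)"
    and I: "?I = Idl\<^bsub>?R\<^esub> (h ` ?A)"
    using ci unfolding complete_intersection_def by blast
  have hA: "h ` ?A \<subseteq> carrier ?R"
    using h by auto
  have F_closed: "?F i \<in> carrier ?R" if "i \<in> ?A" for i
    using torus_binomial_closed s A(1)[OF that] by blast
  have F_in: "?F i \<in> ?I" if "i \<in> ?A" for i
    using torus_binomial_in_vanishing_ideal[OF s A(1)[OF that]] toric_set_subset_proj_torus[OF s]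
    unfolding N_def X by blast
  have h_vanish: "vanishes_on (h j) (toric_set n s v)" if "j \<in> ?A" for j
    using vanishing_idealD(2) poly_ring_Idl_self[OF hA] that unfolding I[symmetric] X by blast
  have h_low: "Poly_Mapping.lookup (h j) (Poly_Mapping.single k b) = 0"
    if "j \<in> ?A" "k \<in> {1..s}" "b < N" for j k b
    using pure_power_coeff_zero[OF s inj supp le1 h(1) h(2) h_vanish, of j k b] that
    unfolding N_def by blast
  have "\<exists>p. (\<forall>j\<in>?A. p j \<in> carrier ?R) \<and> ?F i = (\<Sum>j\<in>?A. p j * h j)" if "i \<in> ?A" for i
    using F_in[OF that] unfolding I poly_ring_Idl_image[OF finite_atLeastAtMost hA] by blast
  then obtain p where p: "\<And>i. i \<in> ?A \<Longrightarrow> ?F i = (\<Sum>j\<in>?A. p i j * h j)"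
    by metis
  define C where "C i j = Poly_Mapping.lookup (p i j) 0" for i j
  define H where "H j k = Poly_Mapping.lookup (h j) (Poly_Mapping.single k N)" for j k
  have single_eq: "Poly_Mapping.single i N = Poly_Mapping.single k N \<longleftrightarrow> i = k" for i k :: nat
    using N by (metis lookup_single_eq lookup_single_not_eq not_one_le_zero)
  have CH: "(\<Sum>j\<in>?A. C i j * H j k) = of_bool (i = k)" if i: "i \<in> ?A" and k: "k \<in> ?A" for i k
  proof -
    have "Poly_Mapping.lookup (p i j * h j) (Poly_Mapping.single k N) = C i j * H j k"
      if "j \<in> ?A" for j
      unfolding C_def H_def
      by (rule lookup_mult_constant_coeff) (metis single_eq_add_obtains h_low that A(1) k)
    then have "(\<Sum>j\<in>?A. C i j * H j k) = Poly_Mapping.lookup (?F i) (Poly_Mapping.single k N)"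
      by (simp add: p[OF i] lookup_sum)
    also have "\<dots> = of_bool (i = k)"
      using A(2)[OF k] by (simp add: tvar_power lookup_minus lookup_single single_eq)
    finally show ?thesis .
  qed
  have HC: "(\<Sum>j\<in>?A. H i j * C j k) = of_bool (i = k)" if "i \<in> ?A" "k \<in> ?A" for i k
    using that by (intro square_left_inverse_is_right_inverse[of "s-1" C H] CH)
  have h_degree: "has_degree N (h j)" if j: "j \<in> ?A" for j
  proof -
    obtain i where "H j i \<noteq> 0"
      using HC[OF j j] by (metis (no_types, lifting) mult_zero_left of_bool_eq(2) sum.neutral zero_neq_one)
    then have "Poly_Mapping.single i N \<in> Poly_Mapping.keys (h j)"
      by (simp add: H_def in_keys_iff)
    moreover obtain d where "has_degree d (h j)"
      using h(2)[OF j] by (auto simp: homogeneous_iff)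
    ultimately show ?thesis
      by (metis has_degree_def mon_degree_single)
  qed
  have F_eq: "?F i = (\<Sum>j\<in>?A. Poly_Mapping.single 0 (C i j) * h j)" if i: "i \<in> ?A" for i
  proof (rule poly_mapping_eqI)
    fix m
    show "Poly_Mapping.lookup (?F i) m =
        Poly_Mapping.lookup (\<Sum>j\<in>?A. Poly_Mapping.single 0 (C i j) * h j) m"
    proof (cases "mon_degree m = N")
      case True
      have "Poly_Mapping.lookup (p i j * h j) m = C i j * Poly_Mapping.lookup (h j) m"
        if j: "j \<in> ?A" for j
        unfolding C_def
      proof (rule lookup_mult_constant_coeff)
        fix a b assume "m = a + b" "a \<noteq> 0"
        then have "mon_degree b \<noteq> N"
          using True mon_degree_eq_0_iff[of a] by (auto simp: mon_degree_add)
        then show "Poly_Mapping.lookup (h j) b = 0"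
          using h_degree[OF j] by (auto simp: has_degree_def in_keys_iff)
      qed
      then show ?thesis
        by (simp add: p[OF i] lookup_sum lookup_const_mult)
    next
      case False
      then have zero: "Poly_Mapping.lookup g m = 0" if "has_degree N g" for g :: "'a mpol"
        using that by (auto simp: has_degree_def in_keys_iff)
      then show ?thesis
        using zero[OF has_degree_torus_binomial] h_degree by (simp add: lookup_sum lookup_const_mult)
    qed
  qed
  have h_eq: "h l = (\<Sum>i\<in>?A. Poly_Mapping.single 0 (H l i) * ?F i)" if l: "l \<in> ?A" for l
  proof -
    have "(\<Sum>i\<in>?A. Poly_Mapping.single 0 (H l i) * ?F i) =
        (\<Sum>i\<in>?A. \<Sum>j\<in>?A. Poly_Mapping.single 0 (H l i * C i j) * h j)"
      by (intro sum.cong refl) (simp add: F_eq sum_distrib_left mult_single flip: mult.assoc)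
    also have "\<dots> = (\<Sum>j\<in>?A. (\<Sum>i\<in>?A. Poly_Mapping.single 0 (H l i * C i j)) * h j)"
      by (subst sum.swap) (simp add: sum_distrib_right)
    also have "\<dots> = (\<Sum>j\<in>?A. Poly_Mapping.single 0 (\<Sum>i\<in>?A. H l i * C i j) * h j)"
    proof -
      have "(\<Sum>i\<in>B. Poly_Mapping.single 0 (g i)) = (Poly_Mapping.single 0 (\<Sum>i\<in>B. g i) :: 'a mpol)"
        for g and B :: "nat set"
        by (induction B rule: infinite_finite_induct) (auto simp: single_add)
      then show ?thesis
        by simp
    qed
    also have "\<dots> = (\<Sum>j\<in>?A. if j = l then h j else 0)"
      by (intro sum.cong refl) (simp only: HC[OF l] of_bool_def, simp)
    also have "\<dots> = h l"
      using l by simp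
    finally show ?thesis ..
  qed
  have FA: "?F ` ?A \<subseteq> carrier ?R"
    using F_closed by auto
  note J = poly_ring_Idl_ideal[OF FA]
  have "?I \<subseteq> Idl\<^bsub>?R\<^esub> (?F ` ?A)"
    unfolding I
  proof (intro poly_ring_Idl_minimal[OF J] image_subsetI)
    fix l assume "l \<in> ?A"
    then show "h l \<in> Idl\<^bsub>?R\<^esub> (?F ` ?A)"
      using poly_ring_Idl_self[OF FA]
      by (simp only: h_eq, intro poly_ring_ideal_sum[OF J] poly_ring_ideal_mult[OF J])
        (auto intro: poly_ring_single_closed)
  qed
  moreover have "Idl\<^bsub>?R\<^esub> (?F ` ?A) \<subseteq> ?I"
    using F_in by (intro poly_ring_Idl_minimal ideal_vanishing_ideal) auto
  ultimately show ?thesis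
    by blast
qed

section \<open>The vanishing ideal of the projective torus\<close>

text \<open>
  As long as some variable \<open>t\<^sub>i\<close> with \<open>i < s\<close> has an exponent of at least \<open>N\<close>, the binomial for \<open>i\<close>
  trades \<open>t\<^sub>i\<^sup>N\<close> for \<open>t\<^sub>s\<^sup>N\<close>.  This keeps the degree and lowers the total exponent of \<open>t\<^sub>1, \<dots>, t\<^bsub>s-1\<^esub>\<close>.
\<close>

lemma reduce_monomial_mod_torus_binomials:
  fixes m :: "nat \<Rightarrow>\<^sub>0 nat"
  assumes s: "s \<ge> 1" and N: "N \<ge> 1" and m: "Poly_Mapping.keys m \<subseteq> {1..s}"
    and I: "ideal I (poly_ring s)" "\<And>i. i \<in> {1..s-1} \<Longrightarrow> torus_binomial N s i \<in> I"
  shows "\<exists>m'. Poly_Mapping.keys m' \<subseteq> {1..s} \<and> mon_degree m' = mon_degree m \<and>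
    (\<forall>i\<in>{1..s-1}. Poly_Mapping.lookup m' i = Poly_Mapping.lookup m i mod N) \<and>
    Poly_Mapping.single m 1 - Poly_Mapping.single m' 1 \<in> (I :: 'a::comm_ring_1 mpol set)"
  using m
proof (induction "\<Sum>i\<in>{1..s-1}. Poly_Mapping.lookup m i" arbitrary: m rule: less_induct)
  case less
  show ?case
  proof (cases "\<forall>i\<in>{1..s-1}. Poly_Mapping.lookup m i < N")
    case True
    then show ?thesis
      using less.prems poly_ring_ideal_zero[OF I(1)] by (intro exI[of _ m]) auto
  next
    case False
    then obtain i where i: "i \<in> {1..s-1}" "N \<le> Poly_Mapping.lookup m i"
      by (auto simp: not_less)
    then have "i \<noteq> s"
      using s by auto
    define a where "a = m - Poly_Mapping.single i N"
    define m1 where "m1 = a + Poly_Mapping.single s N"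
    have m_eq: "m = a + Poly_Mapping.single i N"
      using i by (intro poly_mapping_eqI) (auto simp: a_def lookup_add lookup_minus lookup_single when_def)
    have a_closed: "Poly_Mapping.keys a \<subseteq> {1..s}"
      using less.prems by (auto simp: m_eq in_keys_iff lookup_add)
    then have m1_closed: "Poly_Mapping.keys m1 \<subseteq> {1..s}"
      using keys_add[of a "Poly_Mapping.single s N"] s by (auto simp: m1_def split: if_splits)
    have lookup_m: "Poly_Mapping.lookup m j = Poly_Mapping.lookup m1 j + (if j = i then N else 0)"
      if "j \<in> {1..s-1}" for j
      using that s by (auto simp: m_eq m1_def lookup_add lookup_single when_def)
    have "(\<Sum>j\<in>{1..s-1}. Poly_Mapping.lookup m j) = (\<Sum>j\<in>{1..s-1}. Poly_Mapping.lookup m1 j) + N"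
      using i(1) by (simp add: lookup_m sum.distrib)
    then obtain m' where m': "Poly_Mapping.keys m' \<subseteq> {1..s}" "mon_degree m' = mon_degree m1"
      "\<forall>j\<in>{1..s-1}. Poly_Mapping.lookup m' j = Poly_Mapping.lookup m1 j mod N"
      "Poly_Mapping.single m1 1 - Poly_Mapping.single m' 1 \<in> I"
      using less.hyps[OF _ m1_closed] N by auto
    have "Poly_Mapping.single m 1 - Poly_Mapping.single m1 1 =
        Poly_Mapping.single a 1 * (torus_binomial N s i :: 'a mpol)"
      by (simp add: m_eq m1_def tvar_power right_diff_distrib mult_single)
    then have "Poly_Mapping.single m 1 - Poly_Mapping.single m1 1 \<in> I"
      using I(2)[OF i(1)] a_closed by (auto intro!: poly_ring_ideal_mult[OF I(1)] poly_ring_single_closed)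
    then have "Poly_Mapping.single m 1 - Poly_Mapping.single m' 1 \<in> I"
      using poly_ring_ideal_add[OF I(1) _ m'(4)] by force
    moreover have "mon_degree m' = mon_degree m"
      using m'(2) by (simp add: m_eq m1_def mon_degree_add)
    moreover have "\<forall>j\<in>{1..s-1}. Poly_Mapping.lookup m' j = Poly_Mapping.lookup m j mod N"
      using m'(3) by (simp add: lookup_m)
    ultimately show ?thesis
      using m'(1) by blast
  qed
qed

text \<open>
  Replacing each monomial of a form \<open>p\<close> of degree \<open>d\<close> by its reduced monomial changes \<open>p\<close> by an
  element of the ideal of the binomials.  Two monomials of degree \<open>d\<close> have the same reduced monomial
  exactly if their exponents of \<open>t\<^sub>1, \<dots>, t\<^bsub>s-1\<^esub>\<close> agree modulo \<open>q - 1\<close>, because the degree then fixes the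
  exponent of \<open>t\<^sub>s\<close>.  If \<open>p\<close> vanishes on the torus, its values at the points with \<open>t\<^sub>s = 1\<close> show that
  the coefficients of \<open>p\<close> cancel within each of these classes, and nothing remains.
\<close>

lemma vanishing_ideal_proj_torus:
  fixes s :: nat
  defines "N \<equiv> CARD('a::{finite,field}) - 1"
  assumes s: "s \<ge> 1"
  shows "vanishing_ideal s (proj_torus s :: (nat \<Rightarrow> 'a) set set) =
    Idl\<^bsub>poly_ring s\<^esub> (torus_binomial N s ` {1..s-1})" (is "?I = ?J")
proof
  have N: "N \<ge> 1"
    using two_le_card[where 'a='a] by (simp add: N_def)
  have FA: "torus_binomial N s ` {1..s-1} \<subseteq> (carrier (poly_ring s) :: 'a mpol set)"
    using s by (auto simp del: One_nat_def intro!: torus_binomial_closed)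
  note J = poly_ring_Idl_ideal[OF FA]
  show "?J \<subseteq> ?I"
    using s torus_binomial_in_vanishing_ideal[of s _ "proj_torus s :: (nat \<Rightarrow> 'a) set set"]
    by (intro poly_ring_Idl_minimal ideal_vanishing_ideal) (auto simp: N_def simp del: One_nat_def)
  show "?I \<subseteq> ?J"
  proof (rule vanishing_ideal_subsetI[OF J])
    fix p :: "'a mpol"
    assume p: "p \<in> carrier (poly_ring s)" "homogeneous p" "vanishes_on p (proj_torus s)"
    let ?K = "Poly_Mapping.keys p"
    obtain d where d: "\<And>m. m \<in> ?K \<Longrightarrow> mon_degree m = d"
      using p(2) by (auto simp: homogeneous_def)
    have supp: "Poly_Mapping.keys m \<subseteq> {1..s}" if "m \<in> ?K" for m
      using p(1) that by (auto simp: poly_ring_def)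
    have gen: "torus_binomial N s i \<in> ?J" if "i \<in> {1..s-1}" for i
      using poly_ring_Idl_self[OF FA] that by blast
    have "\<forall>m\<in>?K. \<exists>m'. Poly_Mapping.keys m' \<subseteq> {1..s} \<and> mon_degree m' = d \<and>
        (\<forall>i\<in>{1..s-1}. Poly_Mapping.lookup m' i = Poly_Mapping.lookup m i mod N) \<and>
        Poly_Mapping.single m 1 - Poly_Mapping.single m' 1 \<in> ?J"
      using reduce_monomial_mod_torus_binomials[OF s N supp J gen] d by metis
    then obtain r where r: "\<And>m. m \<in> ?K \<Longrightarrow> Poly_Mapping.keys (r m) \<subseteq> {1..s}"
      "\<And>m. m \<in> ?K \<Longrightarrow> mon_degree (r m) = d"
      "\<And>m i. m \<in> ?K \<Longrightarrow> i \<in> {1..s-1} \<Longrightarrow> Poly_Mapping.lookup (r m) i = Poly_Mapping.lookup m i mod N"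
      "\<And>m. m \<in> ?K \<Longrightarrow> Poly_Mapping.single m 1 - Poly_Mapping.single (r m) 1 \<in> ?J"
      by metis
    have split: "{1..s} = insert s {1..s-1}" "s \<notin> {1..s-1}"
      using s by auto
    \<comment> \<open>Dehomogenize at the last variable.\<close>
    have zero: "(\<Sum>m\<in>?K. Poly_Mapping.lookup p m * (\<Prod>i\<in>{1..s-1}. x i ^ Poly_Mapping.lookup m i)) = 0"
      if x: "\<forall>i\<in>{1..s-1}. x i \<noteq> 0" for x :: "nat \<Rightarrow> 'a"
    proof -
      let ?x = "x(s := 1)"
      have "mon_eval m ?x = (\<Prod>i\<in>{1..s-1}. x i ^ Poly_Mapping.lookup m i)" if "m \<in> ?K" for m
      proof -
        have "mon_eval m ?x = (\<Prod>i\<in>{1..s-1}. ?x i ^ Poly_Mapping.lookup m i)"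
          using split(2) by (simp add: mon_eval_superset[OF _ supp[OF that]] split(1) del: One_nat_def)
        also have "\<dots> = (\<Prod>i\<in>{1..s-1}. x i ^ Poly_Mapping.lookup m i)"
          using split(2) by (intro prod.cong) auto
        finally show ?thesis .
      qed
      moreover have "\<forall>i\<in>{1..s}. ?x i \<noteq> 0"
        using x split(1) by simp
      then have "mpol_eval p ?x = 0"
        using p s by (intro vanishes_on_proj_point[of s _ "proj_torus s"]) (auto simp: proj_torus_eq)
      ultimately show ?thesis
        by (simp add: mpol_eval_superset[OF finite_keys order_refl])
    qed
    have r_eq: "r m = r m0 \<longleftrightarrow> (\<forall>i\<in>{1..s-1}. Poly_Mapping.lookup m i mod N = Poly_Mapping.lookup m0 i mod N)"
      if m: "m \<in> ?K" and m0: "m0 \<in> ?K" for m m0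
    proof
      assume "r m = r m0"
      then show "\<forall>i\<in>{1..s-1}. Poly_Mapping.lookup m i mod N = Poly_Mapping.lookup m0 i mod N"
        using r(3)[OF m] r(3)[OF m0] by metis
    next
      assume mod: "\<forall>i\<in>{1..s-1}. Poly_Mapping.lookup m i mod N = Poly_Mapping.lookup m0 i mod N"
      then have low: "Poly_Mapping.lookup (r m) i = Poly_Mapping.lookup (r m0) i" if "i \<in> {1..s-1}" for i
        using that r(3)[OF m] r(3)[OF m0] by simp
      have "(\<Sum>i\<in>{1..s}. Poly_Mapping.lookup (r m) i) = (\<Sum>i\<in>{1..s}. Poly_Mapping.lookup (r m0) i)"
        using r(1,2)[OF m] r(1,2)[OF m0] by (metis mon_degree_superset finite_atLeastAtMost)
      moreover have "(\<Sum>i\<in>{1..s-1}. Poly_Mapping.lookup (r m) i) = (\<Sum>i\<in>{1..s-1}. Poly_Mapping.lookup (r m0) i)"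
        using low by (rule sum.cong[OF refl])
      ultimately have "Poly_Mapping.lookup (r m) s = Poly_Mapping.lookup (r m0) s"
        using split(2) unfolding split(1) by (simp del: One_nat_def)
      then have "Poly_Mapping.lookup (r m) i = Poly_Mapping.lookup (r m0) i" if "i \<in> {1..s}" for i
        using low that unfolding split(1) by blast
      moreover have "Poly_Mapping.lookup (r m) i = Poly_Mapping.lookup (r m0) i" if "i \<notin> {1..s}" for i
        using r(1)[OF m] r(1)[OF m0] that by (metis in_keys_iff subsetD)
      ultimately show "r m = r m0"
        by (intro poly_mapping_eqI) blast
    qed
    have "(\<Sum>m\<in>?K. Poly_Mapping.single (r m) (Poly_Mapping.lookup p m)) = 0"
    proof (rule poly_mapping_eqI)
      fix w
      have "Poly_Mapping.lookup (\<Sum>m\<in>?K. Poly_Mapping.single (r m) (Poly_Mapping.lookup p m)) w =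
          (\<Sum>m | m \<in> ?K \<and> r m = w. Poly_Mapping.lookup p m)"
        by (simp add: lookup_sum lookup_single when_def sum.inter_filter)
      also have "\<dots> = 0"
      proof (cases "\<exists>m0\<in>?K. r m0 = w")
        case True
        then obtain m0 where m0: "m0 \<in> ?K" "r m0 = w"
          by blast
        have "{m. m \<in> ?K \<and> r m = w} = {m. m \<in> ?K \<and>
            (\<forall>i\<in>{1..s-1}. Poly_Mapping.lookup m i mod N = Poly_Mapping.lookup m0 i mod N)}"
          unfolding m0(2)[symmetric] by (intro Collect_cong conj_cong refl r_eq m0(1))
        moreover have "(\<Sum>m | m \<in> ?K \<and>
            (\<forall>i\<in>{1..s-1}. Poly_Mapping.lookup m i mod N = Poly_Mapping.lookup m0 i mod N).
            Poly_Mapping.lookup p m) = 0"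
          unfolding N_def using finite_keys finite_atLeastAtMost zero by (rule sum_coeffs_in_exponent_class)
        ultimately show ?thesis
          by (simp only:)
      next
        case False
        then have "{m. m \<in> ?K \<and> r m = w} = {}"
          by blast
        then show ?thesis
          by (simp only: sum.empty)
      qed
      finally show "Poly_Mapping.lookup (\<Sum>m\<in>?K. Poly_Mapping.single (r m) (Poly_Mapping.lookup p m)) w =
          Poly_Mapping.lookup 0 w"
        by simp
    qed
    then have "p = (\<Sum>m\<in>?K. Poly_Mapping.single m (Poly_Mapping.lookup p m) -
        Poly_Mapping.single (r m) (Poly_Mapping.lookup p m))"
      using mpol_expand[of p] by (simp add: sum_subtractf)
    also have "\<dots> = (\<Sum>m\<in>?K. Poly_Mapping.single 0 (Poly_Mapping.lookup p m) *
        (Poly_Mapping.single m 1 - Poly_Mapping.single (r m) 1))"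
      by (simp add: right_diff_distrib mult_single)
    also have "\<dots> \<in> ?J"
      using r(4) by (intro poly_ring_ideal_sum[OF J] poly_ring_ideal_mult[OF J] poly_ring_single_closed) auto
    finally show "p \<in> ?J" .
  qed
qed

section \<open>Recovering the toric set from its vanishing ideal\<close>

lemma not_proportional_minor:
  fixes x z :: "nat \<Rightarrow> 'a::field"
  assumes "s \<ge> 1" "\<forall>i\<in>{1..s}. x i \<noteq> 0" "\<forall>i\<in>{1..s}. z i \<noteq> 0"
    and "proj_point s x \<noteq> proj_point s z"
  shows "\<exists>i\<in>{1..s}. \<exists>j\<in>{1..s}. x i * z j - x j * z i \<noteq> 0"
proof (rule ccontr)
  assume "\<not> ?thesis"
  then have "x i * z s = x s * z i" if "i \<in> {1..s}" for i
    using that assms(1) by auto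
  then have "\<forall>i\<in>{1..s}. x i = (x s / z s) * z i"
    using assms(1,3) by (auto simp: field_simps)
  moreover have "x s / z s \<noteq> 0"
    using assms(1-3) by auto
  ultimately show False
    using proj_point_eqI[OF assms(1,2)] assms(4) by blast
qed

text \<open>
  For each of the finitely many parameter vectors \<open>x\<close> there is a minor of the \<open>2 \<times> s\<close> matrix with
  rows \<open>z\<close> and the image of \<open>x\<close> that does not vanish.  The corresponding linear form vanishes at the
  image of \<open>x\<close> but not at \<open>z\<close>; the product of these forms over all \<open>x\<close> is the required form.
\<close>

lemma separating_form:
  fixes z :: "nat \<Rightarrow> 'a::{finite,field}"
  assumes s: "s \<ge> 1" and z: "\<forall>i\<in>{1..s}. z i \<noteq> 0"
    and notin: "proj_point s z \<notin> toric_set n s v"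
  obtains g where "g \<in> vanishing_ideal s (toric_set n s v)" "mpol_eval g z \<noteq> 0"
proof -
  let ?P = "{1..n} \<rightarrow>\<^sub>E UNIV - {0 :: 'a}"
  let ?y = "monomial_map n v"
  have "finite ?P"
    by (intro finite_PiE) auto
  have "\<exists>i j. i \<in> {1..s} \<and> j \<in> {1..s} \<and> ?y x i * z j - ?y x j * z i \<noteq> 0" if "x \<in> ?P" for x
  proof -
    have "\<forall>i\<in>{1..n}. x i \<noteq> 0"
      using that by (auto simp: PiE_def Pi_def)
    then have "\<forall>i\<in>{1..s}. ?y x i \<noteq> 0" "proj_point s (?y x) \<in> toric_set n s v"
      using s by (auto simp: toric_set_eq monomial_map_nonzero)
    then show ?thesis
      using not_proportional_minor[OF s _ z] notin by metis
  qed
  then obtain a b where ab: "\<And>x. x \<in> ?P \<Longrightarrow> a x \<in> {1..s}" "\<And>x. x \<in> ?P \<Longrightarrow> b x \<in> {1..s}"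
    "\<And>x. x \<in> ?P \<Longrightarrow> ?y x (a x) * z (b x) - ?y x (b x) * z (a x) \<noteq> 0"
    by metis
  define l :: "(nat \<Rightarrow> 'a) \<Rightarrow> 'a mpol" where
    "l x = Poly_Mapping.single (Poly_Mapping.single (b x) 1) (?y x (a x)) -
      Poly_Mapping.single (Poly_Mapping.single (a x) 1) (?y x (b x))" for x
  have l_eval: "mpol_eval (l x) w = ?y x (a x) * w (b x) - ?y x (b x) * w (a x)" for x w
  proof -
    have "mpol_eval (l x) w + mpol_eval (Poly_Mapping.single (Poly_Mapping.single (a x) 1) (?y x (b x))) w =
        mpol_eval (Poly_Mapping.single (Poly_Mapping.single (b x) 1) (?y x (a x))) w"
      by (simp add: l_def flip: mpol_eval_add)
    then show ?thesis
      by (simp add: mpol_eval_single mon_eval_def algebra_simps)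
  qed
  define g where "g = (\<Prod>x\<in>?P. l x)"
  have "g \<in> vanishing_ideal s (toric_set n s v)"
  proof (rule vanishing_idealI)
    show "g \<in> carrier (poly_ring s)"
      unfolding g_def l_def using ab
      by (intro poly_ring_prod_closed poly_ring_diff_closed poly_ring_single_closed) auto
    show "homogeneous g"
      unfolding g_def
    proof (rule homogeneous_prod)
      show "homogeneous (l x)" for x
        unfolding homogeneous_iff l_def
        by (intro exI[of _ 1] has_degree_diff has_degree_single mon_degree_single)
    qed
    show "vanishes_on g (toric_set n s v)"
      unfolding vanishes_on_def
    proof (intro ballI)
      fix Q and w :: "nat \<Rightarrow> 'a" assume "Q \<in> toric_set n s v" "w \<in> Q"
      then obtain x where x: "\<forall>i\<in>{1..n}. x i \<noteq> 0" and "w \<in> proj_point s (?y x)"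
        using s by (auto simp: toric_set_eq)
      then obtain c where w: "\<forall>i\<in>{1..s}. w i = c * ?y x i"
        using monomial_map_nonzero[OF x] s by (subst (asm) mem_proj_point_iff) auto
      let ?x = "restrict x {1..n}"
      have P: "?x \<in> ?P"
        using x by auto
      have "?y ?x = ?y x"
        by (simp add: monomial_map_def fun_eq_iff)
      then have "mpol_eval (l ?x) w = 0"
        using w ab(1,2)[OF P] by (simp add: l_eval)
      then show "mpol_eval g w = 0"
        unfolding g_def mpol_eval_prod using \<open>finite ?P\<close> P by (intro prod_zero bexI[of _ ?x])
    qed
  qed
  moreover have "mpol_eval g z \<noteq> 0"
    unfolding g_def mpol_eval_prod using ab(3) \<open>finite ?P\<close> by (simp add: l_eval)
  ultimately show thesis
    by (rule that)
qed

text \<open>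
  Under the hypothesis \<open>X\<close> and the torus have the same vanishing ideal, so no form that is zero on
  \<open>X\<close> can separate a point of the torus from \<open>X\<close>.
\<close>

lemma toric_set_eq_torus_if_torus_ideal:
  fixes X :: "(nat \<Rightarrow> 'a::{finite,field}) set set"
  assumes s: "s \<ge> 1" and X: "X = toric_set n s v"
    and I: "vanishing_ideal s X = Idl\<^bsub>poly_ring s\<^esub> (torus_binomial (CARD('a) - 1) s ` {1..s-1})"
  shows "X = proj_torus s"
proof
  show "X \<subseteq> proj_torus s"
    unfolding X by (rule toric_set_subset_proj_torus[OF s])
  show "proj_torus s \<subseteq> X"
  proof
    fix P :: "(nat \<Rightarrow> 'a) set" assume "P \<in> proj_torus s"
    then obtain z where z: "\<forall>i\<in>{1..s}. z i \<noteq> 0" "P = proj_point s z"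
      using s by (auto simp: proj_torus_eq)
    show "P \<in> X"
    proof (rule ccontr)
      assume "P \<notin> X"
      then obtain g where g: "g \<in> vanishing_ideal s X" "mpol_eval g z \<noteq> 0"
        using separating_form[OF s z(1)] z(2) X by metis
      have "g \<in> vanishing_ideal s (proj_torus s)"
        using g(1) I vanishing_ideal_proj_torus[OF s, where 'a='a] by simp
      then have "mpol_eval g z = 0"
        using vanishing_idealD s z(1) by (intro vanishes_on_proj_point[of s z "proj_torus s"])
          (auto simp: proj_torus_eq)
      then show False
        using g(2) by simp
    qed
  qed
qed

section \<open>Toric sets of clutters\<close>

lemma lookup_char_vec:
  "Poly_Mapping.lookup (char_vec y n f) i = of_bool (i \<in> {1..n} \<and> y i \<in> f)"
  by (auto simp: char_vec_def lookup_sum lookup_single when_def)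

theorem corollary4p5:
  fixes n s q :: nat
    and y :: "nat \<Rightarrow> 'v" and E :: "'v set set" and v :: "nat \<Rightarrow> (nat \<Rightarrow>\<^sub>0 nat)"
    and X :: "(nat \<Rightarrow> 'a::{finite,field}) set set"
  assumes "q = card (UNIV :: 'a set)"
    and "inj_on y {1..n}"
    and "clutter (y ` {1..n}) E"
    and "s \<ge> 1"
    and "bij_betw v {1..s} (char_vec y n ` E)"
    and "X = toric_set n s v"
  shows "(complete_intersection s (vanishing_ideal s X) \<longleftrightarrow>
           vanishing_ideal s X =
             Idl\<^bsub>poly_ring s\<^esub> ((\<lambda>i. tvar i ^ (q - 1) - tvar s ^ (q - 1)) ` {1..s-1})) \<and>
         (vanishing_ideal s X =
             Idl\<^bsub>poly_ring s\<^esub> ((\<lambda>i. tvar i ^ (q - 1) - tvar s ^ (q - 1)) ` {1..s-1}) \<longleftrightarrow>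
           X = proj_torus s)"
proof -
  have inj: "inj_on v {1..s}"
    using assms(5) by (rule bij_betw_imp_inj_on)
  have v: "\<exists>f. v j = char_vec y n f" if "j \<in> {1..s}" for j
    using bij_betw_apply[OF assms(5) that] by blast
  have supp: "Poly_Mapping.keys (v j) \<subseteq> {1..n}" if "j \<in> {1..s}" for j
    using v[OF that] by (auto simp: in_keys_iff lookup_char_vec)
  have le1: "Poly_Mapping.lookup (v j) i \<le> 1" if "j \<in> {1..s}" for j i
    using v[OF that] by (auto simp: lookup_char_vec)
  let ?I = "vanishing_ideal s X"
  let ?J = "Idl\<^bsub>poly_ring s\<^esub> ((\<lambda>i. tvar i ^ (q - 1) - tvar s ^ (q - 1)) ` {1..s-1}) :: 'a mpol set"
  have "?I = ?J" if "complete_intersection s ?I"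
    using torus_ideal_if_complete_intersection[OF assms(4) inj supp le1 assms(6) that]
    unfolding assms(1) .
  moreover have "complete_intersection s ?I" if "?I = ?J"
  proof -
    have "torus_binomial (q - 1) s i \<in> (carrier (poly_ring s) :: 'a mpol set)" if "i \<in> {1..s-1}" for i
      using that assms(4) by (intro torus_binomial_closed) auto
    moreover have "homogeneous (torus_binomial (q - 1) s i :: 'a mpol)" for i
      by (auto simp: homogeneous_iff intro: has_degree_torus_binomial)
    ultimately show ?thesis
      unfolding complete_intersection_def that
      by (intro exI[of _ "torus_binomial (q - 1) s"] conjI ballI refl)
  qed
  moreover have "X = proj_torus s" if "?I = ?J"
    using toric_set_eq_torus_if_torus_ideal[OF assms(4,6)] that unfolding assms(1) by simp
  moreover have "?I = ?J" if "X = proj_torus s"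
    using vanishing_ideal_proj_torus[OF assms(4), where 'a='a] that unfolding assms(1) by simp
  ultimately show ?thesis
    by blast
qed

end
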